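(* Consider the eigenvalue problem $$-U_{xx}-12\,(\delta_{1/3}+\delta_{2/3})U=\lambda U,\qquad U(0)=U(1)=0.$$ There are exactly two negative eigenvalues $\lambda_1<\lambda_2<0$; $0$ is not an eigenvalue; and there is an infinite, countable number of positive eigenvalues $0<\lambda_3\le\lambda_4\le\cdots$.
   Context: For $x_0\in(0,1)$ and $u\in H_0^1(0,1)$ (identified with its continuous representative), $\delta_{x_0}u\in H^{-1}(0,1)$ is defined by $\langle\delta_{x_0}u,\varphi\rangle_{(H^{-1},H_0^1)}=u(x_0)\varphi(x_0)$ for $\varphi\in H_0^1(0,1)$. A solution of the problem for $\lambda\in\mathbb R$ is $U\in H_0^1(0,1)$ satisfying the equation in $H^{-1}(0,1)$; $\lambda$ is an eigenvalue if a nonzero solution exists. *)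

theory Defs
  imports "HOL-Analysis.Analysis" "HOL-Library.Function_Algebras"
begin

abbreviation unit_measure :: "real measure" where
  "unit_measure \<equiv> lebesgue_on {0<..<1}"

definition L2 :: "(real \<Rightarrow> real) set" where
  "L2 = {f. f \<in> borel_measurable unit_measure \<and> integrable unit_measure (\<lambda>x. (f x)\<^sup>2)}"

text \<open>The \<open>C\<^sup>1\<close> functions with compact support in \<open>(0,1)\<close>. As usual in one dimension, these serve
  as the test functions for weak derivatives and as the set whose closure is \<open>H\<^sub>0\<^sup>1(0,1)\<close>;
  smooth test functions would give the same spaces.\<close>

definition Cc1 :: "(real \<Rightarrow> real) set" where
  "Cc1 = {\<phi>. (\<forall>x. \<phi> differentiable (at x)) \<and> continuous_on UNIV (deriv \<phi>) \<and>
              (\<exists>K. compact K \<and> K \<subseteq> {0<..<1} \<and> (\<forall>x. x \<notin> K \<longrightarrow> \<phi> x = 0))}"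

definition has_weak_deriv :: "(real \<Rightarrow> real) \<Rightarrow> (real \<Rightarrow> real) \<Rightarrow> bool" where
  "has_weak_deriv u g \<longleftrightarrow> g \<in> L2 \<and>
     (\<forall>\<phi>\<in>Cc1. (LINT x|unit_measure. u x * deriv \<phi> x) = - (LINT x|unit_measure. g x * \<phi> x))"

definition H1 :: "(real \<Rightarrow> real) set" where
  "H1 = {u \<in> L2. \<exists>g. has_weak_deriv u g}"

text \<open>A weak derivative is determined up to a null set only; the integrals below do not depend on
  which one is chosen.\<close>

definition weak_deriv :: "(real \<Rightarrow> real) \<Rightarrow> real \<Rightarrow> real" where
  "weak_deriv u = (SOME g. has_weak_deriv u g)"

definition H1_norm :: "(real \<Rightarrow> real) \<Rightarrow> real" where
  "H1_norm u = sqrt ((LINT x|unit_measure. (u x)\<^sup>2) + (LINT x|unit_measure. (weak_deriv u x)\<^sup>2))"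

text \<open>\<open>H\<^sub>0\<^sup>1(0,1)\<close> is the closure of the test functions in \<open>H\<^sup>1(0,1)\<close>. Each class is
  represented by its representative that is continuous on \<open>[0,1]\<close>, set to zero outside
  \<open>[0,1]\<close>, so that equality of classes is equality of functions on the real line and point
  values make sense. The boundary conditions are not imposed separately: they are a consequence of
  the closure.\<close>

definition H01 :: "(real \<Rightarrow> real) set" where
  "H01 = {u \<in> H1. continuous_on {0..1} u \<and> (\<forall>x. x \<notin> {0..1} \<longrightarrow> u x = 0) \<and>
                  (\<forall>\<epsilon>>0. \<exists>\<phi>\<in>Cc1. H1_norm (\<lambda>x. u x - \<phi> x) < \<epsilon>)}"

text \<open>Elements of \<open>H\<^sup>-\<^sup>1(0,1)\<close> are functionals whose arguments are the elements of \<^term>\<open>H01\<close>;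
  two of them are equal if they agree on \<^term>\<open>H01\<close>.\<close>

type_synonym functional = "(real \<Rightarrow> real) \<Rightarrow> real"

definition eq_Hm1 :: "functional \<Rightarrow> functional \<Rightarrow> bool" where
  "eq_Hm1 F G \<longleftrightarrow> (\<forall>\<phi>\<in>H01. F \<phi> = G \<phi>)"

definition delta_mult :: "real \<Rightarrow> (real \<Rightarrow> real) \<Rightarrow> functional" where
  "delta_mult x0 u = (\<lambda>\<phi>. u x0 * \<phi> x0)"

text \<open>The distributional derivative of an \<open>L\<^sup>2\<close> function, extended from test functions to
  \<open>H\<^sub>0\<^sup>1\<close>.\<close>

definition dist_deriv :: "(real \<Rightarrow> real) \<Rightarrow> functional" where
  "dist_deriv v = (\<lambda>\<phi>. - (LINT x|unit_measure. v x * weak_deriv \<phi> x))"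

definition L2_functional :: "(real \<Rightarrow> real) \<Rightarrow> functional" where
  "L2_functional v = (\<lambda>\<phi>. LINT x|unit_measure. v x * \<phi> x)"

definition is_solution :: "real \<Rightarrow> (real \<Rightarrow> real) \<Rightarrow> bool" where
  "is_solution \<mu> U \<longleftrightarrow> U \<in> H01 \<and>
     eq_Hm1 (\<lambda>\<phi>. - dist_deriv (weak_deriv U) \<phi> - 12 * (delta_mult (1/3) U \<phi> + delta_mult (2/3) U \<phi>))
            (\<lambda>\<phi>. \<mu> * L2_functional U \<phi>)"

definition is_eigenvalue :: "real \<Rightarrow> bool" where
  "is_eigenvalue \<mu> \<longleftrightarrow> (\<exists>U. is_solution \<mu> U \<and> U \<noteq> (\<lambda>_. 0))"

definition scale_fun :: "real \<Rightarrow> (real \<Rightarrow> real) \<Rightarrow> (real \<Rightarrow> real)" where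
  "scale_fun c f = (\<lambda>x. c * f x)"

lemma vector_space_scale_fun: "vector_space scale_fun"
  by unfold_locales (auto simp: scale_fun_def fun_eq_iff algebra_simps)

definition multiplicity_of :: "real \<Rightarrow> nat" where
  "multiplicity_of \<mu> = vector_space.dim scale_fun {U. is_solution \<mu> U}"

end

theory Submission
  imports Defs "HOL-Complex_Analysis.Complex_Analysis"
begin

text \<open>Let \<open>s\<close>, \<open>c\<close> be the solutions of \<open>- y'' = \<mu> y\<close> with initial data \<open>(0, 1)\<close> and \<open>(1, 0)\<close>. A weak
  solution is determined by its slope at 0, so every eigenvalue is simple, and \<open>\<mu>\<close> is an eigenvalue
  iff the solution with slope 1 vanishes at 1. The addition formulas factor this value as
  \<open>\<sigma> (2 \<gamma> - 12 \<sigma> - 1) (2 \<gamma> - 12 \<sigma> + 1)\<close> with \<open>\<sigma> = s (1/3)\<close> and \<open>\<gamma> = c (1/3)\<close>. For \<open>\<mu> = - 9 \<tau>\<^sup>2\<close> the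
  condition reads \<open>cosh \<tau> - 2 sinh \<tau> / \<tau> = \<plusminus> 1/2\<close>, whose left-hand side increases strictly from \<open>- 1\<close> to
  infinity, which gives two negative eigenvalues. For \<open>\<mu> = 9 \<theta>\<^sup>2\<close> the eigenvalues correspond to the zeros of
  an entire function of \<open>\<theta>\<close>, hence do not accumulate, and all \<open>\<theta> = n \<pi>\<close> are among them.\<close>

section \<open>Square-integrable functions on the unit interval\<close>

text \<open>A weak solution cannot simply be differentiated twice: \<open>weak_deriv\<close> is a
  choice among almost everywhere equal functions, and the point masses make even a classical
  derivative jump. Regularity is therefore gained by integration: hat functions, used as test
  functions, express \<open>U s\<close> through primitives of \<open>U\<close>. This needs hats to
  be elements of \<open>H01\<close>, which is defined as a closure, so kinked functions have to be
  approximated by C1 functions with compact support. The converse, that the shooting solution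
  satisfies the equation against every element of \<open>H01\<close>, rests on the same closure.
  Ramps cancel the kinks at the masses, so that uniqueness for the equation without masses applies
  up to one mass after the other.\<close>

lemma finite_measure_unit: "finite_measure unit_measure"
  by (intro finite_measure_lebesgue_on) auto

lemma integrable_unit_bounded:
  fixes f :: "real \<Rightarrow> real"
  assumes "f \<in> borel_measurable unit_measure" "\<And>x. x \<in> {0<..<1} \<Longrightarrow> \<bar>f x\<bar> \<le> M"
  shows "integrable unit_measure f"
  using assms finite_measure_unit
  by (intro finite_measure.integrable_const_bound[where B = M]) auto

lemma borel_imp_unit_measurable:
  fixes f :: "real \<Rightarrow> real"
  assumes "f \<in> borel_measurable borel"
  shows "f \<in> borel_measurable unit_measure"
  using assms by (intro measurable_restrict_space1 measurable_completion) simp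

lemma continuous_on_unit_measurable:
  fixes f :: "real \<Rightarrow> real"
  assumes "continuous_on {0<..<1} f"
  shows "f \<in> borel_measurable unit_measure"
  using assms by (intro continuous_imp_measurable_on_sets_lebesgue) auto

lemma continuous_on_unit_integrable:
  fixes f :: "real \<Rightarrow> real"
  assumes "continuous_on {0..1} f"
  shows "integrable unit_measure f"
proof -
  obtain M where "\<And>x. x \<in> {0..1} \<Longrightarrow> \<bar>f x\<bar> \<le> M"
    using compact_imp_bounded[OF compact_continuous_image[OF assms]] unfolding bounded_iff by fastforce
  moreover have "continuous_on {0<..<1} f" by (rule continuous_on_subset[OF assms]) auto
  ultimately show ?thesis
    by (intro integrable_unit_bounded[of _ M] continuous_on_unit_measurable) auto
qed

text \<open>Two integrals are in play: estimates and dominated convergence use the Bochner integral,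
  while primitives, additivity over intervals and the fundamental theorem use the gauge integral on
  closed intervals. They agree because endpoints are negligible.\<close>

lemma integral_unit:
  fixes h :: "real \<Rightarrow> real"
  assumes "integrable unit_measure h"
  shows "integral\<^sup>L unit_measure h = integral {0..1} h" "h integrable_on {0..1}"
proof -
  have "h integrable_on {0<..<1}" using assms by (intro integrable_on_lebesgue_on) auto
  then show "h integrable_on {0..1}" by (simp add: integrable_on_open_interval_real)
  have "integral\<^sup>L unit_measure h = integral {0<..<1} h" using assms by (intro lebesgue_integral_eq_integral) auto
  then show "integral\<^sup>L unit_measure h = integral {0..1} h" by (simp add: integral_open_interval_real)
qed

lemma integral_unit_Icc:
  fixes h :: "real \<Rightarrow> real"
  assumes "integrable unit_measure h" "0 \<le> a" "b \<le> 1"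
  shows "integrable unit_measure (\<lambda>x. indicat_real {a..b} x * h x)"
    "(LINT x|unit_measure. indicat_real {a..b} x * h x) = integral {a..b} h"
proof -
  have "{a..b} \<inter> {0<..<1} \<in> sets unit_measure" by (subst sets_restrict_space_iff) auto
  from integrable_mult_indicator[OF this assms(1)]
  have "integrable unit_measure (\<lambda>x. indicat_real ({a..b} \<inter> {0<..<1}) x * h x)" by simp
  then show i: "integrable unit_measure (\<lambda>x. indicat_real {a..b} x * h x)"
    by (subst Bochner_Integration.integrable_cong[where g = "\<lambda>x. indicat_real ({a..b} \<inter> {0<..<1}) x * h x"])
      (auto simp: indicator_def)
  have "integral {0..1} (\<lambda>x. indicat_real {a..b} x * h x) = integral {0..1} (\<lambda>x. if x \<in> {a..b} then h x else 0)"
    by (intro arg_cong[where f = "integral _"]) (auto simp: indicator_def)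
  also have "\<dots> = integral ({0..1} \<inter> {a..b}) h" by (subst Int_commute) (rule integral_restrict_Int)
  also have "{0..1} \<inter> {a..b} = {a..b}" using assms by auto
  finally show "(LINT x|unit_measure. indicat_real {a..b} x * h x) = integral {a..b} h"
    using integral_unit(1)[OF i] by simp
qed

text \<open>The finite exceptional set \<open>P\<close> admits functions with kinks; continuity of
  \<open>F\<close> across them suffices.\<close>

lemma integral_unit_FTC:
  fixes F f :: "real \<Rightarrow> real"
  assumes "finite P" "continuous_on {0..1} F"
    "\<And>x. x \<in> {0<..<1} - P \<Longrightarrow> (F has_real_derivative f x) (at x)"
    "integrable unit_measure f"
  shows "integral\<^sup>L unit_measure f = F 1 - F 0"
proof -
  have "(f has_integral F 1 - F 0) {0..1}"
    using assms by (intro fundamental_theorem_of_calculus_interior_strong[of P])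
      (auto simp: has_real_derivative_iff_has_vector_derivative)
  then show ?thesis using integral_unit(1)[OF assms(4)] by (simp add: integral_unique)
qed

lemma L2_bounded:
  fixes f :: "real \<Rightarrow> real"
  assumes "f \<in> borel_measurable unit_measure" "\<And>x. x \<in> {0<..<1} \<Longrightarrow> \<bar>f x\<bar> \<le> M"
  shows "f \<in> L2"
proof -
  have "\<bar>(f x)\<^sup>2\<bar> \<le> M\<^sup>2" if "x \<in> {0<..<1}" for x
    using power_mono[OF assms(2)[OF that], of 2] by simp
  with assms(1) show ?thesis unfolding L2_def
    by (auto intro!: integrable_unit_bounded[where M = "M\<^sup>2"])
qed

lemma L2_measurable: "f \<in> L2 \<Longrightarrow> f \<in> borel_measurable unit_measure"
  by (simp add: L2_def)

lemma L2_mult_integrable: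
  assumes "f \<in> L2" "g \<in> L2"
  shows "integrable unit_measure (\<lambda>x. f x * g x)"
proof (rule Bochner_Integration.integrable_bound)
  show "integrable unit_measure (\<lambda>x. (f x)\<^sup>2 + (g x)\<^sup>2)" using assms by (auto simp: L2_def)
  have "\<bar>a * b\<bar> \<le> a\<^sup>2 + b\<^sup>2" for a b :: real
    using sum_squares_bound[of "\<bar>a\<bar>" "\<bar>b\<bar>"] mult_nonneg_nonneg[OF abs_ge_zero[of a] abs_ge_zero[of b]]
    unfolding abs_mult power2_abs by linarith
  then show "AE x in unit_measure. norm (f x * g x) \<le> norm ((f x)\<^sup>2 + (g x)\<^sup>2)" by simp
  show "(\<lambda>x. f x * g x) \<in> borel_measurable unit_measure"
    using assms[THEN L2_measurable] by measurable
qed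

lemma L2_const: "(\<lambda>_. c) \<in> L2"
  by (rule L2_bounded[where M = "\<bar>c\<bar>"]) auto

lemma L2_integrable: "f \<in> L2 \<Longrightarrow> integrable unit_measure f"
  using L2_mult_integrable[of f "\<lambda>_. 1"] L2_const by simp

lemma L2_continuous: "continuous_on {0..1} f \<Longrightarrow> f \<in> L2"
  unfolding L2_def
  by (auto intro!: continuous_on_unit_integrable continuous_on_unit_measurable continuous_intros
      intro: continuous_on_subset)

lemma L2_diff:
  assumes "f \<in> L2" "g \<in> L2"
  shows "(\<lambda>x. f x - g x) \<in> L2"
proof -
  have "integrable unit_measure (\<lambda>x. (f x)\<^sup>2 - 2 * (f x * g x) + (g x)\<^sup>2)"
    using assms L2_mult_integrable[OF assms] by (auto simp: L2_def)
  moreover have "(f x)\<^sup>2 - 2 * (f x * g x) + (g x)\<^sup>2 = (f x - g x)\<^sup>2" for x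
    by (simp add: power2_diff)
  ultimately show ?thesis using assms[THEN L2_measurable] by (auto simp: L2_def)
qed

text \<open>The unit interval has measure 1, so this is nonnegativity of the variance of
  \<open>\<bar>f\<bar>\<close>: the square of \<open>\<bar>f x\<bar> - m\<close>, with
  \<open>m\<close> the mean, is integrated and expanded.\<close>

lemma integral_abs_le_L2:
  assumes "f \<in> L2"
  shows "(LINT x|unit_measure. \<bar>f x\<bar>) \<le> sqrt (LINT x|unit_measure. (f x)\<^sup>2)"
proof -
  define m where "m = (LINT x|unit_measure. \<bar>f x\<bar>)"
  have i: "integrable unit_measure (\<lambda>x. \<bar>f x\<bar>)" "integrable unit_measure (\<lambda>x. (f x)\<^sup>2)"
    using L2_integrable[OF assms] assms by (auto simp: L2_def)
  have "integrable unit_measure (\<lambda>x. m\<^sup>2)" using L2_integrable[OF L2_const] .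
  then have "(LINT x|unit_measure. (f x)\<^sup>2 - 2 * m * \<bar>f x\<bar> + m\<^sup>2)
    = (LINT x|unit_measure. (f x)\<^sup>2) - 2 * m * m + m\<^sup>2"
    using i by (simp add: m_def measure_restrict_space)
  moreover have "0 \<le> (LINT x|unit_measure. (f x)\<^sup>2 - 2 * m * \<bar>f x\<bar> + m\<^sup>2)"
  proof (rule Bochner_Integration.integral_nonneg)
    fix x show "0 \<le> (f x)\<^sup>2 - 2 * m * \<bar>f x\<bar> + m\<^sup>2"
      using zero_le_power2[of "\<bar>f x\<bar> - m"] by (simp add: power2_diff algebra_simps)
  qed
  ultimately have "m\<^sup>2 \<le> (LINT x|unit_measure. (f x)\<^sup>2)" by (simp add: power2_eq_square)
  then show ?thesis unfolding m_def by (rule real_le_rsqrt)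
qed

lemma integral_abs_le_sup:
  fixes f g :: "real \<Rightarrow> real"
  assumes "f \<in> borel_measurable unit_measure" "\<And>x. x \<in> {0<..<1} \<Longrightarrow> \<bar>f x\<bar> \<le> M" "integrable unit_measure g"
  shows "integrable unit_measure (\<lambda>x. f x * g x)"
    "\<bar>LINT x|unit_measure. f x * g x\<bar> \<le> M * (LINT x|unit_measure. \<bar>g x\<bar>)"
proof -
  have b: "AE x in unit_measure. norm (f x * g x) \<le> M * \<bar>g x\<bar>"
    using assms(2) by (auto simp: abs_mult intro!: mult_right_mono AE_I2)
  have i: "integrable unit_measure (\<lambda>x. M * \<bar>g x\<bar>)" using assms(3) by auto
  show j: "integrable unit_measure (\<lambda>x. f x * g x)"
    using b borel_measurable_integrable[OF assms(3)] assms(1)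
    by (intro Bochner_Integration.integrable_bound[OF i]) (auto simp: elim!: eventually_mono)
  have "\<bar>LINT x|unit_measure. f x * g x\<bar> \<le> (LINT x|unit_measure. \<bar>f x * g x\<bar>)"
    by (rule integral_abs_bound)
  also have "\<dots> \<le> (LINT x|unit_measure. M * \<bar>g x\<bar>)"
    using b by (intro integral_mono_AE i integrable_abs j) auto
  finally show "\<bar>LINT x|unit_measure. f x * g x\<bar> \<le> M * (LINT x|unit_measure. \<bar>g x\<bar>)" by simp
qed

section \<open>Weak derivatives of continuous functions\<close>

lemma Cc1_I:
  fixes \<phi> \<phi>' :: "real \<Rightarrow> real"
  assumes "\<And>x. (\<phi> has_real_derivative \<phi>' x) (at x)" "continuous_on UNIV \<phi>'"
    "0 < a" "b < 1" "\<And>x. x \<notin> {a..b} \<Longrightarrow> \<phi> x = 0"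
  shows "\<phi> \<in> Cc1" "deriv \<phi> = \<phi>'"
proof -
  show d: "deriv \<phi> = \<phi>'" using assms(1) DERIV_imp_deriv by blast
  show "\<phi> \<in> Cc1" unfolding Cc1_def
    using assms by (auto simp: d real_differentiable_def intro!: exI[of _ "{a..b}"])
qed

lemma Cc1_DERIV: "\<phi> \<in> Cc1 \<Longrightarrow> (\<phi> has_real_derivative deriv \<phi> x) (at x)"
  by (simp add: Cc1_def DERIV_deriv_iff_real_differentiable)

lemma Cc1_continuous_on: "\<phi> \<in> Cc1 \<Longrightarrow> continuous_on S \<phi>"
  by (rule DERIV_continuous_on) (rule has_field_derivative_at_within[OF Cc1_DERIV])

lemma Cc1_deriv_continuous_on: "\<phi> \<in> Cc1 \<Longrightarrow> continuous_on S (deriv \<phi>)"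
  by (auto simp: Cc1_def intro: continuous_on_subset)

lemma Cc1_outside: "\<phi> \<in> Cc1 \<Longrightarrow> x \<notin> {0<..<1} \<Longrightarrow> \<phi> x = 0"
  by (auto simp: Cc1_def)

lemma Cc1_L2: "\<phi> \<in> Cc1 \<Longrightarrow> \<phi> \<in> L2" "\<phi> \<in> Cc1 \<Longrightarrow> deriv \<phi> \<in> L2"
  by (simp_all add: L2_continuous Cc1_continuous_on Cc1_deriv_continuous_on)

lemma Cc1_has_weak_deriv:
  assumes "\<phi> \<in> Cc1"
  shows "has_weak_deriv \<phi> (deriv \<phi>)"
  unfolding has_weak_deriv_def
proof (intro conjI ballI)
  show "deriv \<phi> \<in> L2" using assms by (rule Cc1_L2)
  fix \<psi> assume \<psi>: "\<psi> \<in> Cc1"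
  have i: "integrable unit_measure (\<lambda>x. \<phi> x * deriv \<psi> x)" "integrable unit_measure (\<lambda>x. deriv \<phi> x * \<psi> x)"
    using assms \<psi> by (auto intro!: L2_mult_integrable Cc1_L2)
  have "(LINT x|unit_measure. \<phi> x * deriv \<psi> x + deriv \<phi> x * \<psi> x) = \<phi> 1 * \<psi> 1 - \<phi> 0 * \<psi> 0"
  proof (rule integral_unit_FTC[of "{}"])
    show "((\<lambda>x. \<phi> x * \<psi> x) has_real_derivative \<phi> x * deriv \<psi> x + deriv \<phi> x * \<psi> x) (at x)" for x
      using DERIV_mult[OF Cc1_DERIV[OF assms] Cc1_DERIV[OF \<psi>], of x] by (simp add: ac_simps)
    show "continuous_on {0..1} (\<lambda>x. \<phi> x * \<psi> x)"
      by (intro continuous_on_mult Cc1_continuous_on assms \<psi>)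
  qed (use i in auto)
  then show "(LINT x|unit_measure. \<phi> x * deriv \<psi> x) = - (LINT x|unit_measure. deriv \<phi> x * \<psi> x)"
    using i Cc1_outside[OF assms] by simp
qed

lemma has_weak_deriv_L2: "has_weak_deriv u g \<Longrightarrow> g \<in> L2"
  by (simp add: has_weak_deriv_def)

lemma has_weak_deriv_diff:
  assumes "u \<in> L2" "v \<in> L2" "has_weak_deriv u g" "has_weak_deriv v h"
  shows "has_weak_deriv (\<lambda>x. u x - v x) (\<lambda>x. g x - h x)"
proof -
  have gh: "g \<in> L2" "h \<in> L2" using assms by (auto simp: has_weak_deriv_def)
  show ?thesis unfolding has_weak_deriv_def
  proof (intro conjI ballI)
    show "(\<lambda>x. g x - h x) \<in> L2" using gh by (rule L2_diff)
    fix \<phi> assume \<phi>: "\<phi> \<in> Cc1"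
    show "(LINT x|unit_measure. (u x - v x) * deriv \<phi> x) = - (LINT x|unit_measure. (g x - h x) * \<phi> x)"
      using assms gh \<phi> by (simp add: left_diff_distrib L2_mult_integrable Cc1_L2 has_weak_deriv_def)
  qed
qed

section \<open>C1 step functions and tent-shaped approximate identities\<close>

lemma DERIV_pos_part:
  fixes f f' :: "real \<Rightarrow> real"
  assumes "\<And>t. (f has_real_derivative f' t) (at t)" "f 0 = 0" "f' 0 = 0"
  shows "((\<lambda>t. if t \<ge> 0 then f t else 0) has_real_derivative (if t \<ge> 0 then f' t else 0)) (at t)"
proof -
  consider "t > 0" | "t < 0" | "t = 0" by linarith
  then show ?thesis
  proof cases
    case 1
    have "((\<lambda>t. if t \<ge> 0 then f t else 0) has_real_derivative f' t) (at t)"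
      by (rule has_field_derivative_transform_within_open[OF assms(1), of "{0<..}"]) (use 1 in auto)
    then show ?thesis using 1 by simp
  next
    case 2
    have "((\<lambda>t. if t \<ge> 0 then f t else 0) has_real_derivative 0) (at t)"
      by (rule has_field_derivative_transform_within_open[OF DERIV_const[of 0], of "{..<0}"]) (use 2 in auto)
    then show ?thesis using 2 by simp
  next
    case 3
    \<comment> \<open>At the gluing point the difference quotient of the truncated function is
      bounded in absolute value by that of \<open>f\<close>, which tends to
      \<open>f' 0 = 0\<close>.\<close>
    have "((\<lambda>h. f h / h) \<longlongrightarrow> 0) (at 0)"
      using assms(1)[of 0] assms(2,3) by (simp add: DERIV_def)
    then have "((\<lambda>h. (if h \<ge> 0 then f h else 0) / h) \<longlongrightarrow> 0) (at 0)"
      by (rule Lim_null_comparison[rotated, OF tendsto_norm_zero])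
        (auto intro!: always_eventually divide_nonneg_neg)
    moreover have "(if 0 + h \<ge> 0 then f (0 + h) else 0) - (if 0 \<ge> (0::real) then f 0 else 0) = (if h \<ge> 0 then f h else 0)" for h
      using assms(2) by simp
    ultimately show ?thesis using 3 assms(3) unfolding DERIV_def by (simp only:) simp
  qed
qed

definition ramp :: "real \<Rightarrow> real" where "ramp t = (if t \<ge> 0 then t else 0)"

text \<open>A quadratic spline rising from 0 at 0 to 1 at 1. Its derivative is the tent on the unit
  interval with peak 2 at 1/2, hence of mass 1. Being C1 is exactly the regularity that
  \<open>Cc1\<close> asks for.\<close>

definition step :: "real \<Rightarrow> real" where
  "step t = 2 * (ramp t)\<^sup>2 - 4 * (ramp (t - 1/2))\<^sup>2 + 2 * (ramp (t - 1))\<^sup>2"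

definition step_deriv :: "real \<Rightarrow> real" where
  "step_deriv t = 4 * ramp t - 8 * ramp (t - 1/2) + 4 * ramp (t - 1)"

lemma continuous_on_ramp [continuous_intros]:
  assumes "continuous_on S f"
  shows "continuous_on S (\<lambda>x. ramp (f x))"
proof -
  have "ramp t = max 0 t" for t by (auto simp: ramp_def)
  then show ?thesis using assms by (simp only:) (intro continuous_on_max continuous_on_const)
qed

lemma DERIV_ramp_sq: "((\<lambda>t. (ramp t)\<^sup>2) has_real_derivative 2 * ramp t) (at t)"
proof -
  have "((\<lambda>t. t\<^sup>2) has_real_derivative 2 * t) (at t)" for t :: real
    by (auto intro!: derivative_eq_intros)
  from DERIV_pos_part[OF this]
  have "((\<lambda>t. if t \<ge> 0 then t\<^sup>2 else 0) has_real_derivative (if t \<ge> 0 then 2 * t else 0)) (at t)"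
    by simp
  moreover have "(\<lambda>t. if t \<ge> 0 then t\<^sup>2 else 0) = (\<lambda>t. (ramp t)\<^sup>2)" by (auto simp: ramp_def)
  moreover have "2 * ramp t = (if t \<ge> 0 then 2 * t else 0)" by (simp add: ramp_def)
  ultimately show ?thesis by (simp only:)
qed

lemma DERIV_step: "(step has_real_derivative step_deriv t) (at t)"
proof -
  have *: "((\<lambda>t. (ramp (t - c))\<^sup>2) has_real_derivative 2 * ramp (t - c)) (at t)" for c
    by (rule DERIV_cong[OF DERIV_chain2[OF DERIV_ramp_sq, of _ 1]]) (auto intro!: derivative_eq_intros)
  have "((\<lambda>t. 2 * (ramp (t - 0))\<^sup>2 - 4 * (ramp (t - 1/2))\<^sup>2 + 2 * (ramp (t - 1))\<^sup>2) has_real_derivative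
    2 * (2 * ramp (t - 0)) - 4 * (2 * ramp (t - 1/2)) + 2 * (2 * ramp (t - 1))) (at t)"
    by (intro DERIV_add DERIV_diff DERIV_cmult *)
  then show ?thesis unfolding step_def[abs_def] step_deriv_def by simp
qed

lemma DERIV_step_affine: "((\<lambda>x. step (m * (x - p) + q)) has_real_derivative m * step_deriv (m * (x - p) + q)) (at x)"
  by (rule DERIV_cong[OF DERIV_chain2[OF DERIV_step]]) (auto intro!: derivative_eq_intros)

lemma continuous_on_step_deriv [continuous_intros]:
  "continuous_on S f \<Longrightarrow> continuous_on S (\<lambda>x. step_deriv (f x))"
  unfolding step_deriv_def by (intro continuous_intros)

lemma continuous_on_step [continuous_intros]:
  "continuous_on S f \<Longrightarrow> continuous_on S (\<lambda>x. step (f x))"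
  unfolding step_def by (intro continuous_intros)

lemma step_eq_0: "t \<le> 0 \<Longrightarrow> step t = 0"
  by (auto simp: step_def ramp_def)

lemma step_eq_1: "t \<ge> 1 \<Longrightarrow> step t = 1"
  by (auto simp: step_def ramp_def power2_eq_square field_simps)

lemma step_deriv_nonneg: "step_deriv t \<ge> 0"
  by (auto simp: step_deriv_def ramp_def)

lemma step_deriv_eq_0: "t \<le> 0 \<or> t \<ge> 1 \<Longrightarrow> step_deriv t = 0"
  by (auto simp: step_deriv_def ramp_def)

lemma step_mono: "s \<le> t \<Longrightarrow> step s \<le> step t"
  using DERIV_step step_deriv_nonneg by (intro DERIV_nonneg_imp_nondecreasing[of s t step]) auto

lemma step_bounds: "0 \<le> step t" "step t \<le> 1"
  using step_mono[of "min 0 t" t] step_mono[of t "max 1 t"] step_eq_0[of "min 0 t"] step_eq_1[of "max 1 t"]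
  by auto

text \<open>The rescaled tents form an approximate identity at \<open>p\<close>: nonnegative, of
  mass 1, supported between \<open>p - q / m k\<close> and \<open>p + (1 - q) / m k\<close>. The
  offset \<open>q\<close> decides on which side of \<open>p\<close> the support lies.\<close>

lemma LIMSEQ_step_kernel:
  fixes u :: "real \<Rightarrow> real" and m :: "nat \<Rightarrow> real"
  assumes u: "continuous_on {0..1} u" and p: "0 < p" "p < 1" and q: "0 \<le> q" "q \<le> 1"
    and m: "filterlim m at_top sequentially"
  shows "(\<lambda>k. LINT x|unit_measure. u x * (m k * step_deriv (m k * (x - p) + q))) \<longlonglongrightarrow> u p"
proof (rule tendstoI)
  fix e :: real assume "e > 0"
  then have e: "e / 2 > 0" by simp
  have "p \<in> {0..1}" using p by auto
  then obtain d where d: "d > 0" "\<And>x. x \<in> {0..1} \<Longrightarrow> dist x p < d \<Longrightarrow> dist (u x) (u p) < e / 2"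
    using u e unfolding continuous_on_iff by metis
  \<comment> \<open>The bounds \<open>1/p\<close> and \<open>1/(1-p)\<close> keep the support inside
    the unit interval, so that no mass is lost; \<open>1/d\<close> keeps it where \<open>u\<close>
    is within \<open>e/2\<close> of \<open>u p\<close>.\<close>
  have "eventually (\<lambda>k. m k > 0 \<and> m k \<ge> 1/p \<and> m k \<ge> 1/(1-p) \<and> m k > 1/d) sequentially"
    using m[unfolded filterlim_at_top] m[unfolded filterlim_at_top_dense]
    by (intro eventually_conj) auto
  then show "\<forall>\<^sub>F k in sequentially. dist (LINT x|unit_measure. u x * (m k * step_deriv (m k * (x - p) + q))) (u p) < e"
  proof eventually_elim
    case (elim k)
    define K where "K x = m k * step_deriv (m k * (x - p) + q)" for x
    have Kc: "continuous_on {0..1} K" unfolding K_def by (intro continuous_intros)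
    have K0: "K x \<ge> 0" for x unfolding K_def using elim step_deriv_nonneg by (simp add: mult_nonneg_nonneg)
    have "integral\<^sup>L unit_measure K = step (m k * (1 - p) + q) - step (m k * (0 - p) + q)"
      unfolding K_def
      by (intro integral_unit_FTC[of "{}"] continuous_on_unit_integrable continuous_intros DERIV_step_affine finite.emptyI)
    also have "\<dots> = 1"
    proof -
      have "m k * (1 - p) \<ge> 1" "m k * p \<ge> 1" using elim p by (auto simp: field_simps)
      then show ?thesis using q by (subst step_eq_1 step_eq_0; simp add: algebra_simps)+
    qed
    finally have K1: "integral\<^sup>L unit_measure K = 1" .
    have le: "\<bar>(u x - u p) * K x\<bar> \<le> e/2 * K x" if "x \<in> {0<..<1}" for x
    proof (cases "dist x p < d")
      case True
      then have "\<bar>u x - u p\<bar> \<le> e/2" using d(2)[of x] that by (auto simp: dist_real_def)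
      from mult_right_mono[OF this K0[of x]] show ?thesis using K0[of x] by (simp add: abs_mult)
    next
      case False
      have "m k * \<bar>x - p\<bar> \<ge> m k * d" using False elim by (intro mult_left_mono) (auto simp: dist_real_def)
      moreover have "m k * d > 1" using elim d(1) by (simp add: field_simps)
      ultimately have "m k * \<bar>x - p\<bar> > 1" by linarith
      then have "\<bar>m k * (x - p)\<bar> > 1" using elim by (simp add: abs_mult)
      then have "K x = 0" unfolding K_def using q by (subst step_deriv_eq_0) (auto simp: abs_if split: if_splits)
      then show ?thesis by simp
    qed
    have i1: "integrable unit_measure (\<lambda>x. u x * K x)" "integrable unit_measure (\<lambda>x. u p * K x)"
        "integrable unit_measure (\<lambda>x. (u x - u p) * K x)" "integrable unit_measure (\<lambda>x. e/2 * K x)"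
      by (intro continuous_on_unit_integrable continuous_intros u Kc)+
    have "\<bar>(LINT x|unit_measure. u x * K x) - u p\<bar> = \<bar>(LINT x|unit_measure. (u x - u p) * K x)\<bar>"
      using i1 K1 by (simp add: left_diff_distrib)
    also have "\<dots> \<le> (LINT x|unit_measure. \<bar>(u x - u p) * K x\<bar>)" by (rule integral_abs_bound)
    also have "\<dots> \<le> (LINT x|unit_measure. e/2 * K x)"
      using le by (intro integral_mono i1 integrable_abs) auto
    also have "\<dots> = e/2" using K1 by simp
    also have "\<dots> < e" using \<open>e > 0\<close> by simp
    finally show ?case by (simp add: dist_real_def K_def)
  qed
qed

text \<open>The weak derivative is tested with plateau functions that converge to the indicator of
  \<open>{a..b}\<close>. Their derivatives are differences of two tents, which converge to
  evaluation at \<open>a\<close> minus evaluation at \<open>b\<close>.\<close>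

lemma weak_deriv_increment:
  assumes w: "has_weak_deriv u g" and u: "continuous_on {0..1} u" and ab: "0 < a" "a \<le> b" "b < 1"
  shows "integral {a..b} g = u b - u a"
proof -
  \<comment> \<open>Every slope \<open>m k\<close> is at least \<open>N\<close>, and
    \<open>1/N\<close> is smaller than the distances from \<open>a\<close> to 0 and from
    \<open>b\<close> to 1. One compact support thus serves all \<open>k\<close>.\<close>
  define N where "N = 1/a + 1/(1 - b)"
  define m where "m k = real k + N" for k
  have "1/a > 0" "1/(1 - b) > 0" using ab by auto
  then have "N > 1/a" "N > 1/(1 - b)" and N0: "N > 0" unfolding N_def by linarith+
  then have N: "1/N < a" "1/N < 1 - b" "N > 0" using ab by (auto simp: field_simps)
  have mpos: "m k > 0" "m k \<ge> N" for k using N(3) by (auto simp: m_def)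
  have m: "filterlim m at_top sequentially" unfolding m_def
    by (subst add.commute) (rule filterlim_tendsto_add_at_top[OF tendsto_const filterlim_real_sequentially])
  \<comment> \<open>The offsets 1 and 0 place the rise to the left of \<open>a\<close> and the fall
    to the right of \<open>b\<close>. The plateau covers all of \<open>{a..b}\<close>, and at each
    point the limit is attained after finitely many \<open>k\<close>.\<close>
  define \<psi> where "\<psi> k x = step (m k * (x - a) + 1) - step (m k * (x - b) + 0)" for k x
  define \<psi>' where "\<psi>' k x = m k * step_deriv (m k * (x - a) + 1) - m k * step_deriv (m k * (x - b) + 0)" for k x
  have der: "(\<psi> k has_real_derivative \<psi>' k x) (at x)" for k x
    unfolding \<psi>_def \<psi>'_def by (intro DERIV_diff DERIV_step_affine)
  have cont: "continuous_on S (\<psi>' k)" for k S unfolding \<psi>'_def by (intro continuous_intros)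
  have sup: "\<psi> k x = 0" if "x \<notin> {a - 1/N..b + 1/N}" for k x
  proof -
    have "x < a - 1/N \<or> x > b + 1/N" using that by auto
    then show ?thesis
    proof
      assume x: "x < a - 1/N"
      moreover have "1/N > 0" using N by simp
      ultimately have xab: "x \<le> a" "x \<le> b" using ab by linarith+
      have "m k * (a - x) \<ge> N * (1/N)" using x mpos[of k] N by (intro mult_mono) auto
      then have "m k * (x - a) + 1 \<le> 0" using N by (simp add: algebra_simps)
      moreover have "m k * (x - b) \<le> 0" using xab mpos[of k] by (intro mult_nonneg_nonpos) auto
      ultimately show ?thesis by (simp add: \<psi>_def step_eq_0)
    next
      assume x: "x > b + 1/N"
      moreover have "1/N > 0" using N by simp
      ultimately have xab: "x \<ge> a" using ab by linarith
      have "m k * (x - b) \<ge> N * (1/N)" using x mpos[of k] N by (intro mult_mono) auto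
      then have "m k * (x - b) \<ge> 1" using N by simp
      moreover have "m k * (x - a) \<ge> 0" using xab mpos[of k] by (intro mult_nonneg_nonneg) auto
      ultimately show ?thesis by (simp add: \<psi>_def step_eq_1)
    qed
  qed
  have C: "\<psi> k \<in> Cc1" "deriv (\<psi> k) = \<psi>' k" for k
    using Cc1_I[of "\<psi> k" "\<psi>' k" "a - 1/N" "b + 1/N", OF der cont] sup N by auto
  have eq: "(LINT x|unit_measure. u x * \<psi>' k x) = - (LINT x|unit_measure. g x * \<psi> k x)" for k
    using w C[of k] by (auto simp: has_weak_deriv_def)
  have g: "integrable unit_measure g" using w by (intro L2_integrable) (rule has_weak_deriv_L2)
  have lim1: "(\<lambda>k. LINT x|unit_measure. u x * \<psi>' k x) \<longlonglongrightarrow> u a - u b"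
  proof -
    have "(\<lambda>k. (LINT x|unit_measure. u x * (m k * step_deriv (m k * (x - a) + 1)))
        - (LINT x|unit_measure. u x * (m k * step_deriv (m k * (x - b) + 0)))) \<longlonglongrightarrow> u a - u b"
      using ab by (intro tendsto_diff LIMSEQ_step_kernel u m) auto
    moreover have "(LINT x|unit_measure. u x * \<psi>' k x) =
       (LINT x|unit_measure. u x * (m k * step_deriv (m k * (x - a) + 1)))
        - (LINT x|unit_measure. u x * (m k * step_deriv (m k * (x - b) + 0)))" for k
      unfolding \<psi>'_def right_diff_distrib
      by (intro Bochner_Integration.integral_diff continuous_on_unit_integrable continuous_intros u)
    ultimately show ?thesis by simp
  qed
  have lim2: "(\<lambda>k. LINT x|unit_measure. g x * \<psi> k x) \<longlonglongrightarrow> (LINT x|unit_measure. indicat_real {a..b} x * g x)"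
  proof (rule integral_dominated_convergence[where w = "\<lambda>x. \<bar>g x\<bar>"])
    show "integrable unit_measure (\<lambda>x. \<bar>g x\<bar>)" using g by simp
    show "(\<lambda>x. indicat_real {a..b} x * g x) \<in> borel_measurable unit_measure"
      using integral_unit_Icc(1)[OF g, of a b] ab by auto
    have "continuous_on {0<..<1} (\<psi> k)" for k unfolding \<psi>_def by (intro continuous_intros)
    then show "(\<lambda>x. g x * \<psi> k x) \<in> borel_measurable unit_measure" for k
      using g continuous_on_unit_measurable by (intro borel_measurable_times) auto
    have "\<bar>\<psi> k x\<bar> \<le> 1" for k x
      unfolding \<psi>_def using step_bounds[of "m k * (x - a) + 1"] step_bounds[of "m k * (x - b) + 0"]
      by (simp add: abs_if)
    then show "AE x in unit_measure. norm (g x * \<psi> k x) \<le> \<bar>g x\<bar>" for k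
      by (auto simp: abs_mult intro!: mult_left_le)
    have "(\<lambda>k. \<psi> k x) \<longlonglongrightarrow> indicat_real {a..b} x" for x
    proof (rule tendsto_eventually)
      have ev: "eventually (\<lambda>k. m k \<ge> 1/d) sequentially" for d
        using m by (auto simp: filterlim_at_top)
      consider "x < a" | "a \<le> x" "x \<le> b" | "x > b" by linarith
      then show "\<forall>\<^sub>F k in sequentially. \<psi> k x = indicat_real {a..b} x"
      proof cases
        case 1
        show ?thesis using ev[of "a - x"]
        proof eventually_elim
          case (elim k)
          then have "m k * (x - a) + 1 \<le> 0" using 1 by (simp add: field_simps)
          moreover have "m k * (x - b) \<le> 0" using 1 ab mpos[of k] by (intro mult_nonneg_nonpos) auto
          ultimately show ?case using 1 by (simp add: \<psi>_def step_eq_0)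
        qed
      next
        case 2
        have "m k * (x - a) \<ge> 0" "m k * (x - b) \<le> 0" for k
          using 2 mpos[of k] by (auto intro!: mult_nonneg_nonneg mult_nonneg_nonpos)
        then show ?thesis using 2 by (auto simp: \<psi>_def step_eq_1 step_eq_0)
      next
        case 3
        show ?thesis using ev[of "x - b"]
        proof eventually_elim
          case (elim k)
          then have "m k * (x - b) \<ge> 1" using 3 by (simp add: field_simps)
          moreover have "m k * (x - a) \<ge> 0" using 3 ab mpos[of k] by (intro mult_nonneg_nonneg) auto
          ultimately show ?case using 3 by (simp add: \<psi>_def step_eq_1)
        qed
      qed
    qed
    then have "(\<lambda>k. g x * \<psi> k x) \<longlonglongrightarrow> g x * indicat_real {a..b} x" for x
      by (intro tendsto_intros)
    then show "AE x in unit_measure. (\<lambda>k. g x * \<psi> k x) \<longlonglongrightarrow> indicat_real {a..b} x * g x"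
      by (simp add: mult.commute)
  qed
  have "(\<lambda>k. - (LINT x|unit_measure. u x * \<psi>' k x)) \<longlonglongrightarrow> - (u a - u b)"
    using lim1 by (rule tendsto_minus)
  then have "- (u a - u b) = (LINT x|unit_measure. indicat_real {a..b} x * g x)"
    using lim2 eq by (intro LIMSEQ_unique) auto
  also have "\<dots> = integral {a..b} g" using ab by (intro integral_unit_Icc g) auto
  finally show ?thesis by simp
qed

text \<open>By the increment formula, \<open>u\<close> minus the primitive of \<open>g\<close> is
  constant on the open interval, since plateaus stay away from 0 and 1; continuity of both extends
  the constancy to the closed interval.\<close>

lemma weak_deriv_integral:
  assumes w: "has_weak_deriv u g" and u: "continuous_on {0..1} u" and x: "x \<in> {0..1}"
  shows "u x = u 0 + integral {0..x} g"
proof -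
  have g: "g integrable_on {0..1}" using w by (intro integral_unit L2_integrable) (rule has_weak_deriv_L2)
  define D where "D x = u x - integral {0..x} g" for x
  have cl: "closure {0<..<1::real} = {0..1}" by simp
  have D: "continuous_on (closure {0<..<1}) D" unfolding D_def cl
    by (intro continuous_intros u indefinite_integral_continuous_1 g)
  have inc: "D b = D a" if "0 < a" "a \<le> b" "b < 1" for a b
  proof -
    have "integral {0..a} g + integral {a..b} g = integral {0..b} g"
      using that by (intro Henstock_Kurzweil_Integration.integral_combine integrable_on_subinterval[OF g]) auto
    then show ?thesis using weak_deriv_increment[OF w u that] by (simp add: D_def)
  qed
  have eq: "D y = D (1/2)" if "y \<in> {0<..<1}" for y
    using inc[of y "1/2"] inc[of "1/2" y] that by (cases "y \<le> 1/2") auto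
  have "D y = D (1/2)" if "y \<in> {0..1}" for y
    by (rule continuous_constant_on_closure[OF D eq]) (use that cl in simp_all)
  from this[OF x] this[of 0] show ?thesis by (simp add: D_def)
qed

text \<open>\<open>h\<close> is extended by zero and replaced by a Borel function \<open>h0\<close>.
  Its positive and negative parts are densities of two finite measures that agree on all half-lines,
  hence everywhere; by uniqueness of densities the parts coincide almost everywhere, which forces
  both to be 0.\<close>

lemma AE_eq_0_if_integrals_eq_0:
  fixes h :: "real \<Rightarrow> real"
  assumes h: "integrable unit_measure h" and 0: "\<And>x. x \<in> {0..1} \<Longrightarrow> integral {0..x} h = 0"
  shows "AE x in unit_measure. h x = 0"
proof -
  define h1 where "h1 x = indicat_real {0<..<1} x * h x" for x
  have h1: "integrable lebesgue h1" using h unfolding h1_def by (subst (asm) integrable_restrict_space) auto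
  from completion_ex_borel_measurable_real[of h1 lborel] h1
  obtain h0 where h0: "h0 \<in> borel_measurable lborel" "AE x in lborel. h1 x = h0 x" by auto
  have ae: "AE x in lebesgue. h1 x = h0 x" using h0(2) by (rule AE_completion)
  have "integrable lebesgue h0"
    using h1 ae h0(1) by (subst integrable_cong_AE[of _ _ h1]) (auto simp: eq_commute intro: measurable_completion)
  then have h0i: "integrable lborel h0" using h0(1) by (simp add: integrable_completion)
  have tail: "(LINT t|lborel. indicat_real {x<..} t * h0 t) = 0" for x
  proof -
    \<comment> \<open>Clamping \<open>x\<close> to the unit interval turns the integral over any
      half-line into the full integral minus one over \<open>{0..c}\<close>, and both vanish by
      assumption.\<close>
    define c where "c = max 0 (min 1 x)"
    have c: "0 \<le> c" "c \<le> 1" by (auto simp: c_def)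
    have "(LINT t|lborel. indicat_real {x<..} t * h0 t) = (LINT t|lebesgue. indicat_real {x<..} t * h0 t)"
      using h0(1) by (subst integral_completion) auto
    also have "\<dots> = (LINT t|lebesgue. indicat_real {x<..} t * h1 t)"
      using ae h1 h0(1) by (intro integral_cong_AE borel_measurable_times borel_measurable_indicator measurable_completion
          borel_measurable_integrable[OF h1]) auto
    also have "\<dots> = (LINT t|lebesgue. indicat_real {0<..<1} t *\<^sub>R (indicat_real {x<..} t * h t))"
      by (simp add: h1_def mult_ac)
    also have "\<dots> = (LINT t|unit_measure. indicat_real {x<..} t * h t)"
      by (subst integral_restrict_space) auto
    also have "\<dots> = (LINT t|unit_measure. h t - indicat_real {0..c} t * h t)"
      by (intro Bochner_Integration.integral_cong) (auto simp: indicator_def c_def)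
    also have "\<dots> = 0"
      using integral_unit_Icc[OF h, of 0 c] integral_unit(1)[OF h] 0[of c] 0[of 1] h c by auto
    finally show ?thesis .
  qed
  have "density lborel (\<lambda>t. ennreal (max 0 (h0 t))) = density lborel (\<lambda>t. ennreal (max 0 (- h0 t)))"
  proof (rule measure_eqI_lessThan)
    fix x
    have i: "integrable lborel (\<lambda>t. indicat_real {x<..} t * max 0 (h0 t))"
        "integrable lborel (\<lambda>t. indicat_real {x<..} t * max 0 (- h0 t))"
      using integrable_mult_indicator[of "{x<..}" lborel "\<lambda>t. max 0 (h0 t)"]
        integrable_mult_indicator[of "{x<..}" lborel "\<lambda>t. max 0 (- h0 t)"] h0i by auto
    have e: "emeasure (density lborel (\<lambda>t. ennreal (f t))) {x<..} = ennreal (LINT t|lborel. indicat_real {x<..} t * f t)"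
      if "\<And>t. f t \<ge> 0" "f \<in> borel_measurable borel" "integrable lborel (\<lambda>t. indicat_real {x<..} t * f t)" for f
    proof -
      have "emeasure (density lborel (\<lambda>t. ennreal (f t))) {x<..} = (\<integral>\<^sup>+t. ennreal (f t) * indicator {x<..} t \<partial>lborel)"
        using that by (intro emeasure_density) auto
      also have "\<dots> = (\<integral>\<^sup>+t. ennreal (indicat_real {x<..} t * f t) \<partial>lborel)"
        by (intro nn_integral_cong) (auto simp: indicator_def)
      also have "\<dots> = ennreal (LINT t|lborel. indicat_real {x<..} t * f t)"
        using that by (intro nn_integral_eq_integral) auto
      finally show ?thesis .
    qed
    have e1: "emeasure (density lborel (\<lambda>t. ennreal (max 0 (h0 t)))) {x<..} = ennreal (LINT t|lborel. indicat_real {x<..} t * max 0 (h0 t))"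
      using h0(1) i by (intro e) auto
    have e2: "emeasure (density lborel (\<lambda>t. ennreal (max 0 (- h0 t)))) {x<..} = ennreal (LINT t|lborel. indicat_real {x<..} t * max 0 (- h0 t))"
      using h0(1) i by (intro e) auto
    have "(LINT t|lborel. indicat_real {x<..} t * max 0 (h0 t)) - (LINT t|lborel. indicat_real {x<..} t * max 0 (- h0 t))
      = (LINT t|lborel. indicat_real {x<..} t * max 0 (h0 t) - indicat_real {x<..} t * max 0 (- h0 t))"
      using i by simp
    also have "\<dots> = (LINT t|lborel. indicat_real {x<..} t * h0 t)"
      by (intro Bochner_Integration.integral_cong) (auto simp: indicator_def)
    finally show "emeasure (density lborel (\<lambda>t. ennreal (max 0 (h0 t)))) {x<..} = emeasure (density lborel (\<lambda>t. ennreal (max 0 (- h0 t)))) {x<..}"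
      unfolding e1 e2 tail by simp
    show "emeasure (density lborel (\<lambda>t. ennreal (max 0 (h0 t)))) {x<..} < \<infinity>" unfolding e1 by simp
  qed auto
  then have "AE t in lborel. ennreal (max 0 (h0 t)) = ennreal (max 0 (- h0 t))"
    using h0(1) by (intro sigma_finite_measure.density_unique[OF sigma_finite_lborel]) auto
  then have "AE t in lborel. h0 t = 0" by eventually_elim (auto simp: max_def ennreal_eq_0_iff split: if_splits)
  then have "AE t in lebesgue. h0 t = 0" by (rule AE_completion)
  with ae have "AE t in lebesgue. t \<in> {0<..<1} \<longrightarrow> h t = 0"
    by eventually_elim (auto simp: h1_def)
  then show ?thesis by (subst AE_restrict_space_iff) auto
qed

text \<open>The difference is a weak derivative of the zero function, so all its primitives
  vanish.\<close>

lemma weak_deriv_unique: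
  assumes "has_weak_deriv u g" "has_weak_deriv u h"
  shows "AE x in unit_measure. g x = h x"
proof -
  have gh: "g \<in> L2" "h \<in> L2" using assms has_weak_deriv_L2 by auto
  have w: "has_weak_deriv (\<lambda>_. 0) (\<lambda>x. g x - h x)"
    unfolding has_weak_deriv_def
  proof (intro conjI ballI)
    show "(\<lambda>x. g x - h x) \<in> L2" using gh by (rule L2_diff)
    fix \<phi> assume \<phi>: "\<phi> \<in> Cc1"
    show "(LINT x|unit_measure. 0 * deriv \<phi> x) = - (LINT x|unit_measure. (g x - h x) * \<phi> x)"
      using assms \<phi> gh by (simp add: left_diff_distrib L2_mult_integrable Cc1_L2 has_weak_deriv_def)
  qed
  have "AE x in unit_measure. g x - h x = 0"
    using weak_deriv_integral[OF w] gh
    by (intro AE_eq_0_if_integrals_eq_0 L2_integrable L2_diff) auto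
  then show ?thesis by simp
qed

section \<open>The space \<open>H\<^sub>0\<^sup>1\<close>\<close>

lemma H1_has_weak_deriv: "u \<in> H1 \<Longrightarrow> has_weak_deriv u (weak_deriv u)"
  unfolding H1_def weak_deriv_def by (auto intro: someI[of "has_weak_deriv u"])

lemma weak_deriv_AE:
  assumes "has_weak_deriv u g"
  shows "AE x in unit_measure. weak_deriv u x = g x"
proof -
  have "has_weak_deriv u (weak_deriv u)"
    unfolding weak_deriv_def using assms by (rule someI[of "has_weak_deriv u"])
  then show ?thesis using assms by (rule weak_deriv_unique)
qed

text \<open>Allows the arbitrarily chosen \<open>weak_deriv u\<close> to be replaced under the
  integral by an explicit weak derivative.\<close>

lemma integral_mult_weak_deriv:
  assumes "has_weak_deriv u g" "f \<in> borel_measurable unit_measure"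
  shows "(LINT x|unit_measure. f x * weak_deriv u x) = (LINT x|unit_measure. f x * g x)"
proof -
  have "has_weak_deriv u (weak_deriv u)"
    unfolding weak_deriv_def using assms(1) by (rule someI[of "has_weak_deriv u"])
  then have "weak_deriv u \<in> borel_measurable unit_measure" "g \<in> borel_measurable unit_measure"
    using assms(1) has_weak_deriv_L2 L2_measurable by blast+
  then show ?thesis using weak_deriv_AE[OF assms(1)] assms(2)
    by (intro integral_cong_AE) auto
qed

lemma H1_norm_eq:
  assumes "has_weak_deriv u g"
  shows "H1_norm u = sqrt ((LINT x|unit_measure. (u x)\<^sup>2) + (LINT x|unit_measure. (g x)\<^sup>2))"
proof -
  have "has_weak_deriv u (weak_deriv u)"
    unfolding weak_deriv_def using assms(1) by (rule someI[of "has_weak_deriv u"])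
  then have m: "weak_deriv u \<in> borel_measurable unit_measure" "g \<in> borel_measurable unit_measure"
    using assms(1) has_weak_deriv_L2 L2_measurable by blast+
  have "(LINT x|unit_measure. (weak_deriv u x)\<^sup>2) = (LINT x|unit_measure. (g x)\<^sup>2)"
    using weak_deriv_AE[OF assms(1)] m by (intro integral_cong_AE) auto
  then show ?thesis by (simp add: H1_norm_def)
qed

lemma H01_has_weak_deriv: "u \<in> H01 \<Longrightarrow> has_weak_deriv u (weak_deriv u)"
  by (simp add: H01_def H1_has_weak_deriv)

lemma H01_continuous_on: "u \<in> H01 \<Longrightarrow> continuous_on {0..1} u"
  by (simp add: H01_def)

lemma H01_outside: "u \<in> H01 \<Longrightarrow> x \<notin> {0..1} \<Longrightarrow> u x = 0"
  by (simp add: H01_def)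

section \<open>Approximation by test functions and the boundary values of \<open>H01\<close>\<close>

lemma abs_integral_Icc_le:
  fixes g :: "real \<Rightarrow> real"
  assumes "integrable unit_measure g" "x \<le> 1"
  shows "\<bar>integral {0..x} g\<bar> \<le> (LINT t|unit_measure. \<bar>g t\<bar>)"
proof -
  have "indicat_real {0..x} \<in> borel_measurable unit_measure"
    by (intro borel_imp_unit_measurable) auto
  then have "\<bar>LINT t|unit_measure. indicat_real {0..x} t * g t\<bar> \<le> 1 * (LINT t|unit_measure. \<bar>g t\<bar>)"
    by (rule integral_abs_le_sup(2)[OF _ _ assms(1)]) (auto simp: abs_indicator indicator_le_1)
  then show ?thesis using integral_unit_Icc(2)[OF assms(1), of 0 x] assms by simp
qed

lemma H01_approx:
  assumes \<phi>: "\<phi> \<in> H01" and e: "e > 0"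
  obtains \<psi> where "\<psi> \<in> Cc1" "has_weak_deriv (\<lambda>x. \<phi> x - \<psi> x) (\<lambda>x. weak_deriv \<phi> x - deriv \<psi> x)"
    "(LINT x|unit_measure. \<bar>\<phi> x - \<psi> x\<bar>) < e"
    "(LINT x|unit_measure. \<bar>weak_deriv \<phi> x - deriv \<psi> x\<bar>) < e"
proof -
  obtain \<psi> where \<psi>: "\<psi> \<in> Cc1" "H1_norm (\<lambda>x. \<phi> x - \<psi> x) < e" using assms by (auto simp: H01_def)
  define w where "w x = \<phi> x - \<psi> x" for x
  define g where "g x = weak_deriv \<phi> x - deriv \<psi> x" for x
  have L: "\<phi> \<in> L2" using \<phi> by (intro L2_continuous H01_continuous_on)
  have w: "w \<in> L2" unfolding w_def by (rule L2_diff[OF L Cc1_L2(1)[OF \<psi>(1)]])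
  have wg: "has_weak_deriv w g" unfolding w_def g_def
    by (rule has_weak_deriv_diff[OF L Cc1_L2(1)[OF \<psi>(1)] H01_has_weak_deriv[OF \<phi>] Cc1_has_weak_deriv[OF \<psi>(1)]])
  then have g: "g \<in> L2" by (rule has_weak_deriv_L2)
  have "H1_norm w < e" using \<psi>(2) unfolding w_def .
  then have *: "sqrt ((LINT x|unit_measure. (w x)\<^sup>2) + (LINT x|unit_measure. (g x)\<^sup>2)) < e"
    unfolding H1_norm_eq[OF wg] .
  have nn: "(LINT x|unit_measure. (w x)\<^sup>2) \<ge> 0" "(LINT x|unit_measure. (g x)\<^sup>2) \<ge> 0"
    by (intro Bochner_Integration.integral_nonneg; simp)+
  have "(LINT x|unit_measure. \<bar>w x\<bar>) \<le> sqrt (LINT x|unit_measure. (w x)\<^sup>2)" by (rule integral_abs_le_L2[OF w])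
  also have "\<dots> \<le> sqrt ((LINT x|unit_measure. (w x)\<^sup>2) + (LINT x|unit_measure. (g x)\<^sup>2))"
    using nn by (intro real_sqrt_le_mono) simp
  finally have 1: "(LINT x|unit_measure. \<bar>w x\<bar>) < e" using * by simp
  have "(LINT x|unit_measure. \<bar>g x\<bar>) \<le> sqrt (LINT x|unit_measure. (g x)\<^sup>2)" by (rule integral_abs_le_L2[OF g])
  also have "\<dots> \<le> sqrt ((LINT x|unit_measure. (w x)\<^sup>2) + (LINT x|unit_measure. (g x)\<^sup>2))"
    using nn by (intro real_sqrt_le_mono) simp
  finally have 2: "(LINT x|unit_measure. \<bar>g x\<bar>) < e" using * by simp
  show ?thesis
    by (rule that[OF \<psi>(1) wg[unfolded w_def[abs_def] g_def[abs_def]]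
          1[unfolded w_def] 2[unfolded g_def]])
qed

text \<open>Closeness in the \<open>H1\<close> norm says nothing directly about one point. As \<psi>
  vanishes at 0, \<open>\<phi> 0\<close> equals \<open>\<phi> x - \<psi> x\<close> minus an integral
  of the derivative difference; averaging over \<open>x\<close> bounds it by two small L1
  norms.\<close>

lemma H01_0:
  assumes \<phi>: "\<phi> \<in> H01"
  shows "\<phi> 0 = 0"
proof -
  have "\<bar>\<phi> 0\<bar> \<le> 0 + e" if "e > 0" for e
  proof -
    from \<open>e > 0\<close> have "e / 2 > 0" by simp
    from H01_approx[OF \<phi> this] obtain \<psi> where \<psi>: "\<psi> \<in> Cc1"
        and wd: "has_weak_deriv (\<lambda>x. \<phi> x - \<psi> x) (\<lambda>x. weak_deriv \<phi> x - deriv \<psi> x)"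
      and w: "(LINT x|unit_measure. \<bar>\<phi> x - \<psi> x\<bar>) < e/2"
      and g: "(LINT x|unit_measure. \<bar>weak_deriv \<phi> x - deriv \<psi> x\<bar>) < e/2" .
    define G where "G = (LINT x|unit_measure. \<bar>weak_deriv \<phi> x - deriv \<psi> x\<bar>)"
    have c: "continuous_on {0..1} (\<lambda>x. \<phi> x - \<psi> x)"
      using \<phi> \<psi> by (intro continuous_on_diff H01_continuous_on Cc1_continuous_on)
    have gi: "integrable unit_measure (\<lambda>x. weak_deriv \<phi> x - deriv \<psi> x)"
      using has_weak_deriv_L2[OF wd] by (rule L2_integrable)
    have le: "\<bar>\<phi> 0\<bar> \<le> \<bar>\<phi> x - \<psi> x\<bar> + G" if "x \<in> {0<..<1}" for x
    proof -
      have "\<phi> x - \<psi> x = \<phi> 0 + integral {0..x} (\<lambda>x. weak_deriv \<phi> x - deriv \<psi> x)"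
        using weak_deriv_integral[OF wd c, of x] that Cc1_outside[OF \<psi>, of 0] by simp
      moreover have "\<bar>integral {0..x} (\<lambda>x. weak_deriv \<phi> x - deriv \<psi> x)\<bar> \<le> G"
        unfolding G_def using that gi by (intro abs_integral_Icc_le) auto
      ultimately show ?thesis by linarith
    qed
    have ci: "integrable unit_measure (\<lambda>x. \<bar>\<phi> x - \<psi> x\<bar>)"
      using c by (intro integrable_abs continuous_on_unit_integrable)
    have "(LINT x|unit_measure. \<bar>\<phi> 0\<bar>) \<le> (LINT x|unit_measure. \<bar>\<phi> x - \<psi> x\<bar> + G)"
      using le ci L2_integrable[OF L2_const] by (intro integral_mono Bochner_Integration.integrable_add) auto
    then have "\<bar>\<phi> 0\<bar> \<le> (LINT x|unit_measure. \<bar>\<phi> x - \<psi> x\<bar>) + G"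
      using ci L2_integrable[OF L2_const, of G] by (simp add: measure_restrict_space)
    then show ?thesis using w g unfolding G_def by linarith
  qed
  then have "\<bar>\<phi> 0\<bar> \<le> 0" by (rule field_le_epsilon)
  then show ?thesis by simp
qed

lemma H01_integral:
  assumes "\<phi> \<in> H01" "x \<in> {0..1}"
  shows "integral {0..x} (weak_deriv \<phi>) = \<phi> x"
  using weak_deriv_integral[OF H01_has_weak_deriv[OF assms(1)] H01_continuous_on[OF assms(1)] assms(2)]
    H01_0[OF assms(1)] by simp

text \<open>The one-dimensional Sobolev bound: a function vanishing at 0 is bounded by the L1 norm
  of its derivative. It makes point evaluations continuous.\<close>

lemma H01_approx_sup:
  assumes \<phi>: "\<phi> \<in> H01" and \<psi>: "\<psi> \<in> Cc1" and x: "x \<in> {0..1}"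
    and wd: "has_weak_deriv (\<lambda>x. \<phi> x - \<psi> x) (\<lambda>x. weak_deriv \<phi> x - deriv \<psi> x)"
  shows "\<bar>\<phi> x - \<psi> x\<bar> \<le> (LINT x|unit_measure. \<bar>weak_deriv \<phi> x - deriv \<psi> x\<bar>)"
proof -
  have c: "continuous_on {0..1} (\<lambda>x. \<phi> x - \<psi> x)"
    using \<phi> \<psi> by (intro continuous_on_diff H01_continuous_on Cc1_continuous_on)
  have "\<phi> x - \<psi> x = integral {0..x} (\<lambda>x. weak_deriv \<phi> x - deriv \<psi> x)"
    using weak_deriv_integral[OF wd c x] Cc1_outside[OF \<psi>, of 0] H01_0[OF \<phi>] by simp
  then show ?thesis
    using x abs_integral_Icc_le[OF L2_integrable[OF has_weak_deriv_L2[OF wd]], of x] by simp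
qed

lemma H01_1:
  assumes \<phi>: "\<phi> \<in> H01"
  shows "\<phi> 1 = 0"
proof -
  have "\<bar>\<phi> 1\<bar> \<le> 0 + e" if "e > 0" for e
  proof -
    from H01_approx[OF \<phi> that] obtain \<psi> where \<psi>: "\<psi> \<in> Cc1"
        and wd: "has_weak_deriv (\<lambda>x. \<phi> x - \<psi> x) (\<lambda>x. weak_deriv \<phi> x - deriv \<psi> x)"
      and g: "(LINT x|unit_measure. \<bar>weak_deriv \<phi> x - deriv \<psi> x\<bar>) < e" .
    show ?thesis using H01_approx_sup[OF \<phi> \<psi> _ wd, of 1] Cc1_outside[OF \<psi>, of 1] g by simp
  qed
  then have "\<bar>\<phi> 1\<bar> \<le> 0" by (rule field_le_epsilon)
  then show ?thesis by simp
qed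

text \<open>Zero mean is what makes the primitive vanish to the right of \<open>b\<close>, so that
  its support is compact.\<close>

lemma Cc1_primitive:
  fixes h :: "real \<Rightarrow> real"
  assumes h: "continuous_on UNIV h" and ab: "0 < a" "a \<le> b" "b < 1" and 0: "\<And>x. x \<notin> {a..b} \<Longrightarrow> h x = 0"
    and i: "integral {0..1} h = 0"
  defines "\<phi> \<equiv> \<lambda>x. if x \<in> {0..1} then integral {0..x} h else 0"
  shows "\<phi> \<in> Cc1" "deriv \<phi> = h"
proof -
  have io: "h integrable_on {p..q}" for p q
    by (intro integrable_continuous_real continuous_on_subset[OF h]) auto
  have z: "\<phi> x = 0" if "x \<notin> {a..b}" for x
  proof (cases "x \<in> {0..1}")
    case True
    show ?thesis
    proof (cases "x < a")
      case True
      then have "integral {0..x} h = integral {0..x} (\<lambda>_. 0)" using 0 ab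
        by (intro Henstock_Kurzweil_Integration.integral_cong) auto
      then show ?thesis by (simp add: \<phi>_def)
    next
      case False
      then have "x > b" using that by auto
      then have "integral {x..1} h = integral {x..1} (\<lambda>_. 0)" using 0 ab
        by (intro Henstock_Kurzweil_Integration.integral_cong) auto
      moreover have "integral {0..x} h + integral {x..1} h = integral {0..1} h"
        using \<open>x \<in> {0..1}\<close> by (intro Henstock_Kurzweil_Integration.integral_combine io) auto
      ultimately show ?thesis using i by (simp add: \<phi>_def)
    qed
  qed (auto simp: \<phi>_def)
  have d: "(\<phi> has_real_derivative h x) (at x)" for x
  proof (cases "x \<in> {a..b}")
    case True
    then have x: "x \<in> {0<..<1}" using ab by auto
    have "((\<lambda>x. integral {0..x} h) has_real_derivative h x) (at x within {0..1})"
      using x by (intro integral_has_real_derivative continuous_on_subset[OF h]) auto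
    then have "((\<lambda>x. integral {0..x} h) has_real_derivative h x) (at x)"
      using x by (simp add: at_within_Icc_at)
    then show ?thesis
      by (rule has_field_derivative_transform_within_open[of _ _ _ "{0<..<1}"]) (use x in \<open>auto simp: \<phi>_def\<close>)
  next
    case False
    have "(\<phi> has_real_derivative 0) (at x)"
      by (rule has_field_derivative_transform_within_open[OF DERIV_const[of 0], of "- {a..b}"])
        (use False z in auto)
    then show ?thesis using False 0 by simp
  qed
  show "\<phi> \<in> Cc1" "deriv \<phi> = h"
    using Cc1_I[OF d h ab(1,3) z] by auto
qed

section \<open>Primitives of piecewise continuous functions belong to \<open>H01\<close>\<close>

lemma AE_unit_not_in_finite:
  assumes "finite P"
  shows "AE x in unit_measure. x \<notin> P"
proof -
  have "AE x in lebesgue. x \<notin> P"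
    using assms by (intro AE_not_in) (simp add: negligible_finite flip: negligible_iff_null_sets)
  then show ?thesis by (subst AE_restrict_space_iff) (auto elim: eventually_mono)
qed

lemma step_deriv_le: "step_deriv t \<le> 2"
  by (auto simp: step_deriv_def ramp_def)

text \<open>\<open>g\<close> is the derivative of a function with finitely many kinks that vanishes
  at both ends. The endpoints are put into \<open>P\<close> so that cutting off near
  \<open>P\<close> also clears a neighbourhood of the boundary.\<close>

locale piecewise_continuous =
  fixes P :: "real set" and g :: "real \<Rightarrow> real" and M :: real
  assumes P: "finite P" "0 \<in> P" "1 \<in> P"
    and bound: "\<And>x. \<bar>g x\<bar> \<le> M"
    and cont: "\<And>x. x \<notin> P \<Longrightarrow> isCont g x"
    and outside: "\<And>x. x \<notin> {0..1} \<Longrightarrow> g x = 0"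
    and mean: "integral {0..1} g = 0"
begin

definition u :: "real \<Rightarrow> real" where "u x = (if x \<in> {0..1} then integral {0..x} g else 0)"

lemma measurable_g: "g \<in> borel_measurable borel"
  using P(1) cont
  by (intro borel_measurable_continuous_countable_exceptions[of P])
    (auto intro: countable_finite intro!: continuous_at_imp_continuous_on)

lemma L2_g: "g \<in> L2"
  using bound by (intro L2_bounded borel_imp_unit_measurable measurable_g)

lemma integrable_g: "g integrable_on {0..1}"
  using integral_unit(2)[OF L2_integrable[OF L2_g]] .

lemma continuous_on_u: "continuous_on {0..1} u"
  using indefinite_integral_continuous_1[OF integrable_g]
  by (rule continuous_on_eq) (auto simp: u_def)

lemma DERIV_u:
  assumes "x \<in> {0<..<1} - P"
  shows "(u has_real_derivative g x) (at x)"
proof -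
  have "((\<lambda>x. integral {0..x} g) has_vector_derivative g x) (at x within {0..1} - {})"
    using assms cont[of x]
    by (intro integral_has_vector_derivative_continuous_at integrable_g)
      (auto intro: continuous_at_imp_continuous_at_within)
  then have "((\<lambda>x. integral {0..x} g) has_real_derivative g x) (at x)"
    using assms by (simp add: at_within_Icc_at has_real_derivative_iff_has_vector_derivative)
  then show ?thesis
    by (rule has_field_derivative_transform_within_open[of _ _ _ "{0<..<1}"]) (use assms in \<open>auto simp: u_def\<close>)
qed

lemma has_weak_deriv_u: "has_weak_deriv u g"
  unfolding has_weak_deriv_def
proof (intro conjI ballI)
  fix \<psi> assume \<psi>: "\<psi> \<in> Cc1"
  have i: "integrable unit_measure (\<lambda>x. u x * deriv \<psi> x)" "integrable unit_measure (\<lambda>x. g x * \<psi> x)"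
    by (rule L2_mult_integrable[OF L2_continuous[OF continuous_on_u] Cc1_L2(2)[OF \<psi>]])
      (rule L2_mult_integrable[OF L2_g Cc1_L2(1)[OF \<psi>]])
  have "(LINT x|unit_measure. u x * deriv \<psi> x + g x * \<psi> x) = u 1 * \<psi> 1 - u 0 * \<psi> 0"
  proof (rule integral_unit_FTC[OF P(1)])
    show "continuous_on {0..1} (\<lambda>x. u x * \<psi> x)"
      by (intro continuous_on_mult continuous_on_u Cc1_continuous_on \<psi>)
    show "((\<lambda>x. u x * \<psi> x) has_real_derivative u x * deriv \<psi> x + g x * \<psi> x) (at x)"
      if "x \<in> {0<..<1} - P" for x
      using DERIV_mult[OF DERIV_u[OF that] Cc1_DERIV[OF \<psi>, of x]] by (simp add: ac_simps)
  qed (use i in auto)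
  then show "(LINT x|unit_measure. u x * deriv \<psi> x) = - (LINT x|unit_measure. g x * \<psi> x)"
    using i Cc1_outside[OF \<psi>] by simp
qed (rule L2_g)

text \<open>The density \<^term>\<open>g\<close> is cut off near the points of \<^term>\<open>P\<close>, and a multiple of a fixed
  bump restores the zero mean, so that the primitive is a test function.\<close>

lemma Cc1_primitive_approx:
  assumes e: "e > 0"
  obtains h where "(\<lambda>x. if x \<in> {0..1} then integral {0..x} h else 0) \<in> Cc1"
    "deriv (\<lambda>x. if x \<in> {0..1} then integral {0..x} h else 0) = h"
    "continuous_on UNIV h" "(LINT x|unit_measure. (g x - h x)\<^sup>2) < e"
proof -
  \<comment> \<open>A continuous function vanishing exactly on \<open>P\<close>. One cut-off then
    handles all exceptional points: \<open>step (real k * d x - 1)\<close> is 0 where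
    \<open>real k * d x\<close> is at most 1, and 1 where it is at least 2.\<close>
  define d where "d x = (\<Prod>p\<in>P. \<bar>x - p\<bar>)" for x :: real
  have dc: "continuous_on S d" for S unfolding d_def by (intro continuous_intros)
  have d0: "d x = 0" if "x \<in> P" for x using P(1) that by (auto simp: d_def)
  have dpos: "d x > 0" if "x \<notin> P" for x unfolding d_def using that by (intro prod_pos) auto
  define f where "f k x = g x * step (real k * d x - 1)" for k x
  have fb: "\<bar>f k x\<bar> \<le> M" for k x
  proof -
    have "\<bar>f k x\<bar> = \<bar>g x\<bar> * step (real k * d x - 1)" by (simp add: f_def abs_mult step_bounds)
    also have "\<dots> \<le> \<bar>g x\<bar> * 1" by (intro mult_left_mono step_bounds) auto
    finally show ?thesis using bound[of x] by simp
  qed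
  have near: "open {y. real k * d y < 1}" for k
    by (intro open_Collect_less continuous_intros dc)
  have fz: "f k y = 0" if "real k * d y < 1" for k y
    using that by (simp add: f_def step_eq_0)
  have fc: "continuous_on UNIV (f k)" for k
  proof -
    have "isCont (f k) x" for x
    proof (cases "x \<in> P")
      case True
      have "eventually (\<lambda>y. y \<in> {y. real k * d y < 1}) (nhds x)"
        by (rule eventually_nhds_in_open[OF near]) (use d0[OF True] in auto)
      then have "eventually (\<lambda>y. f k y = 0) (nhds x)" by eventually_elim (use fz in auto)
      then show ?thesis by (subst isCont_cong) auto
    next
      case False
      have "isCont d x" using dc[of UNIV] by (simp add: continuous_on_eq_continuous_at)
      then have "isCont (\<lambda>x. real k * d x - 1) x" by (intro continuous_intros)
      then have "isCont (\<lambda>x. step (real k * d x - 1)) x"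
        by (rule isCont_o2[OF _ DERIV_isCont[OF DERIV_step]])
      then show ?thesis unfolding f_def using cont[OF False] by (intro continuous_intros)
    qed
    then show ?thesis by (simp add: continuous_on_eq_continuous_at)
  qed
  \<comment> \<open>A tent of mass 1 and height 4 on \<open>{1/4..3/4}\<close>; subtracting
    \<open>c k\<close> times it cancels the mean of \<open>f k\<close>.\<close>
  define bump where "bump x = 2 * step_deriv (2 * (x - 1/4) + 0)" for x
  have bc: "continuous_on S bump" for S unfolding bump_def by (intro continuous_intros)
  have bi: "integral\<^sup>L unit_measure bump = 1"
  proof -
    have "integral\<^sup>L unit_measure bump = step (2 * (1 - 1/4) + 0) - step (2 * (0 - 1/4) + 0)"
      unfolding bump_def
      by (intro integral_unit_FTC[of "{}"] continuous_on_unit_integrable continuous_intros DERIV_step_affine finite.emptyI)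
    then show ?thesis by (simp add: step_eq_0 step_eq_1)
  qed
  have bb: "\<bar>bump x\<bar> \<le> 4" for x
    using step_deriv_le[of "2 * (x - 1/4) + 0"] step_deriv_nonneg[of "2 * (x - 1/4) + 0"]
    by (simp add: bump_def)
  have bz: "bump x = 0" if "x \<notin> {1/4..3/4}" for x
    using that by (auto simp: bump_def step_deriv_eq_0)
  define c where "c k = integral\<^sup>L unit_measure (f k)" for k
  define h where "h k x = f k x - c k * bump x" for k x
  have fi: "integrable unit_measure (f k)" for k
    by (intro continuous_on_unit_integrable continuous_on_subset[OF fc]) auto
  have bint: "integrable unit_measure bump" by (intro continuous_on_unit_integrable bc)
  have hc: "continuous_on S (h k)" for k S
    unfolding h_def by (intro continuous_intros bc continuous_on_subset[OF fc]) auto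
  have f_lim: "AE x in unit_measure. (\<lambda>k. f k x) \<longlonglongrightarrow> g x"
    using AE_unit_not_in_finite[OF P(1)]
  proof eventually_elim
    case (elim x)
    have "eventually (\<lambda>k. real k * d x - 1 \<ge> 1) sequentially"
      using dpos[OF elim] by (intro eventually_mono[OF eventually_ge_at_top[of "nat \<lceil>2 / d x\<rceil>"]])
        (auto simp: field_simps nat_le_iff ceiling_le_iff)
    then have "eventually (\<lambda>k. f k x = g x) sequentially"
      by eventually_elim (simp add: f_def step_eq_1)
    then show ?case by (rule tendsto_eventually)
  qed
  have M0: "M \<ge> 0" using bound[of 0] by linarith
  have c_lim: "c \<longlonglongrightarrow> 0"
  proof -
    have "(\<lambda>k. integral\<^sup>L unit_measure (f k)) \<longlonglongrightarrow> integral\<^sup>L unit_measure g"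
    proof (rule integral_dominated_convergence[where w = "\<lambda>_. M"])
      show "integrable unit_measure (\<lambda>_. M)" by (rule L2_integrable[OF L2_const])
      show "g \<in> borel_measurable unit_measure" by (rule L2_measurable[OF L2_g])
      show "f k \<in> borel_measurable unit_measure" for k using fi by auto
    qed (use f_lim fb in auto)
    then show ?thesis
      using integral_unit(1)[OF L2_integrable[OF L2_g]] mean by (simp add: c_def[abs_def])
  qed
  have cb: "\<bar>c k\<bar> \<le> M" for k
  proof -
    have "\<bar>c k\<bar> \<le> (LINT x|unit_measure. \<bar>f k x\<bar>)" unfolding c_def by (rule integral_abs_bound)
    also have "\<dots> \<le> (LINT x|unit_measure. M)"
      using fb fi L2_integrable[OF L2_const] by (intro integral_mono integrable_abs) auto
    also have "\<dots> = M" by (simp add: measure_restrict_space)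
    finally show ?thesis .
  qed
  have "(\<lambda>k. LINT x|unit_measure. (g x - h k x)\<^sup>2) \<longlonglongrightarrow> (LINT x|unit_measure. 0)"
  proof (rule integral_dominated_convergence[where w = "\<lambda>_. (6 * M)\<^sup>2"])
    show "integrable unit_measure (\<lambda>_. (6 * M)\<^sup>2)" by (rule L2_integrable[OF L2_const])
    show "(\<lambda>x. (g x - h k x)\<^sup>2) \<in> borel_measurable unit_measure" for k
      using L2_measurable[OF L2_g] continuous_on_unit_measurable[OF hc] by measurable
    show "AE x in unit_measure. (\<lambda>k. (g x - h k x)\<^sup>2) \<longlonglongrightarrow> 0"
      using f_lim
    proof eventually_elim
      case (elim x)
      have "(\<lambda>k. (g x - (f k x - c k * bump x))\<^sup>2) \<longlonglongrightarrow> (g x - (g x - 0 * bump x))\<^sup>2"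
        by (intro tendsto_intros elim c_lim)
      then show ?case by (simp add: h_def)
    qed
    \<comment> \<open>\<open>M\<close> for \<open>g\<close>, \<open>M\<close> for its cut-off, and
      \<open>4 * M\<close> for the corrector, since \<open>\<bar>c k\<bar> \<le> M\<close> and the
      bump is at most 4.\<close>
    have "\<bar>g x - h k x\<bar> \<le> 6 * M" for k x
    proof -
      have "\<bar>c k * bump x\<bar> \<le> M * 4" unfolding abs_mult using cb bb M0 by (intro mult_mono) auto
      then show ?thesis unfolding h_def using bound[of x] fb[of k x] by linarith
    qed
    then have "\<bar>g x - h k x\<bar>\<^sup>2 \<le> (6 * M)\<^sup>2" for k x by (intro power_mono) auto
    then show "AE x in unit_measure. norm ((g x - h k x)\<^sup>2) \<le> (6 * M)\<^sup>2" for k by simp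
  qed auto
  then have "(\<lambda>k. LINT x|unit_measure. (g x - h k x)\<^sup>2) \<longlonglongrightarrow> 0" by simp
  then have "eventually (\<lambda>k. (LINT x|unit_measure. (g x - h k x)\<^sup>2) < e) sequentially"
    using e by (rule order_tendstoD)
  then obtain k where k: "(LINT x|unit_measure. (g x - h k x)\<^sup>2) < e" by (auto simp: eventually_sequentially)
  obtain \<delta>0 where d0': "\<delta>0 > 0" "ball 0 \<delta>0 \<subseteq> {y. real k * d y < 1}"
    using openE[OF near[of k], of 0] d0[OF P(2)] by auto
  obtain \<delta>1 where d1': "\<delta>1 > 0" "ball 1 \<delta>1 \<subseteq> {y. real k * d y < 1}"
    using openE[OF near[of k], of 1] d0[OF P(3)] by auto
  \<comment> \<open>Outside \<open>{a..b}\<close> a point of the unit interval lies in one of the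
    two balls, where the cut-off function is 0; the bounds 1/4 and 3/4 keep the bump inside.\<close>
  define a where "a = min (\<delta>0/2) (1/4)"
  define b where "b = max (1 - \<delta>1/2) (3/4)"
  have ab: "0 < a" "a \<le> b" "b < 1" using d0' d1' by (auto simp: a_def b_def)
  have hz: "h k x = 0" if "x \<notin> {a..b}" for x
  proof -
    have "bump x = 0" using that by (intro bz) (auto simp: a_def b_def)
    moreover have "f k x = 0"
    proof (cases "x \<in> {0..1}")
      case True
      then have "x \<in> ball 0 \<delta>0 \<or> x \<in> ball 1 \<delta>1"
        using that d0'(1) d1'(1) by (auto simp: dist_real_def a_def b_def)
      then show ?thesis using d0' d1' fz by auto
    qed (simp add: f_def outside)
    ultimately show ?thesis by (simp add: h_def)
  qed
  have "integral\<^sup>L unit_measure (h k) = 0"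
    unfolding h_def using fi bint bi by (simp add: c_def)
  then have hi: "integral {0..1} (h k) = 0"
    using integral_unit(1)[OF continuous_on_unit_integrable[OF hc]] by simp
  show ?thesis
    by (rule that[OF Cc1_primitive[OF hc ab hz hi] hc k])
qed

lemma u_H01: "u \<in> H01"
proof -
  have "\<exists>\<phi>\<in>Cc1. H1_norm (\<lambda>x. u x - \<phi> x) < e" if "e > 0" for e
  proof -
    define \<phi> :: "(real \<Rightarrow> real) \<Rightarrow> real \<Rightarrow> real" where "\<phi> h x = (if x \<in> {0..1} then integral {0..x} h else 0)" for h and x :: real
    \<comment> \<open>With \<open>s\<close> the squared L2 error of the derivatives, the functions
      themselves differ by at most \<open>sqrt s\<close>, so the squared \<open>H1\<close> distance
      is at most \<open>2 * s\<close>.\<close>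
    from that have "e\<^sup>2 / 2 > 0" by simp
    from Cc1_primitive_approx[OF this] obtain h where h: "\<phi> h \<in> Cc1" "deriv (\<phi> h) = h"
      "continuous_on UNIV h" "(LINT x|unit_measure. (g x - h x)\<^sup>2) < e\<^sup>2 / 2"
      unfolding \<phi>_def[abs_def] .
    define s where "s = (LINT x|unit_measure. (g x - h x)\<^sup>2)"
    have hL: "h \<in> L2" using h(3) by (intro L2_continuous) (rule continuous_on_subset, auto)
    have gh: "(\<lambda>x. g x - h x) \<in> L2" by (rule L2_diff[OF L2_g hL])
    have wd: "has_weak_deriv (\<lambda>x. u x - \<phi> h x) (\<lambda>x. g x - h x)"
      using Cc1_has_weak_deriv[OF h(1)] h(1,2)
      by (intro has_weak_deriv_diff has_weak_deriv_u L2_continuous continuous_on_u Cc1_continuous_on) auto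
    have s0: "s \<ge> 0" unfolding s_def by (intro Bochner_Integration.integral_nonneg) simp
    have le: "(u x - \<phi> h x)\<^sup>2 \<le> s" if "x \<in> {0<..<1}" for x
    proof -
      have "u x - \<phi> h x = integral {0..x} (\<lambda>x. g x - h x)"
        using that integrable_g integral_unit(2)[OF L2_integrable[OF hL]]
        by (subst Henstock_Kurzweil_Integration.integral_diff)
          (auto simp: u_def \<phi>_def intro: integrable_on_subinterval)
      also have "\<bar>\<dots>\<bar> \<le> (LINT t|unit_measure. \<bar>g t - h t\<bar>)"
        using that by (intro abs_integral_Icc_le L2_integrable gh) auto
      also have "\<dots> \<le> sqrt s" unfolding s_def by (rule integral_abs_le_L2[OF gh])
      finally have "\<bar>u x - \<phi> h x\<bar>\<^sup>2 \<le> (sqrt s)\<^sup>2" by (intro power_mono) auto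
      then show ?thesis using s0 by simp
    qed
    have i: "integrable unit_measure (\<lambda>x. (u x - \<phi> h x)\<^sup>2)"
      using L2_diff[OF L2_continuous[OF continuous_on_u] Cc1_L2(1)[OF h(1)]] by (simp add: L2_def)
    have "(LINT x|unit_measure. (u x - \<phi> h x)\<^sup>2) \<le> (LINT x|unit_measure. s)"
      using le i L2_integrable[OF L2_const] by (intro integral_mono) auto
    then have "(LINT x|unit_measure. (u x - \<phi> h x)\<^sup>2) \<le> s" by (simp add: measure_restrict_space)
    then have "(LINT x|unit_measure. (u x - \<phi> h x)\<^sup>2) + s < e\<^sup>2" using h(4) unfolding s_def by linarith
    then have "H1_norm (\<lambda>x. u x - \<phi> h x) < sqrt (e\<^sup>2)"
      unfolding H1_norm_eq[OF wd] s_def by (intro real_sqrt_less_mono)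
    then show ?thesis using h(1) \<open>e > 0\<close> by auto
  qed
  moreover have "u \<in> H1" unfolding H1_def using has_weak_deriv_u L2_continuous[OF continuous_on_u] by auto
  ultimately show ?thesis unfolding H01_def using continuous_on_u by (auto simp: u_def)
qed

end

text \<open>Density argument: for bounded \<open>g\<close> and continuous \<open>f\<close>, the
  difference \<open>T\<close> of the two sides changes by at most \<open>C\<close> times the L1 norm
  of the derivative difference when \<phi> is replaced by a test function, and \<open>T\<close> is 0
  for test functions. \<open>C\<close> sums the bounds of the four terms, with 1 added for
  positivity.\<close>

lemma H01_weak_identity:
  fixes f g :: "real \<Rightarrow> real"
  assumes g: "g \<in> borel_measurable unit_measure" "\<And>x. x \<in> {0<..<1} \<Longrightarrow> \<bar>g x\<bar> \<le> M"
    and f: "continuous_on {0..1} f" and pq: "p \<in> {0..1}" "q \<in> {0..1}" and \<phi>: "\<phi> \<in> H01"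
    and eq: "\<And>\<psi>. \<psi> \<in> Cc1 \<Longrightarrow> (LINT x|unit_measure. g x * deriv \<psi> x)
      = a * \<psi> p + b * \<psi> q + (LINT x|unit_measure. f x * \<psi> x)"
  shows "(LINT x|unit_measure. g x * weak_deriv \<phi> x)
      = a * \<phi> p + b * \<phi> q + (LINT x|unit_measure. f x * \<phi> x)"
proof -
  have "bounded (f ` {0..1})" by (intro compact_imp_bounded compact_continuous_image f) auto
  then obtain F where F: "\<And>x. x \<in> {0..1} \<Longrightarrow> \<bar>f x\<bar> \<le> F" unfolding bounded_iff by fastforce
  define C where "C = \<bar>M\<bar> + \<bar>a\<bar> + \<bar>b\<bar> + \<bar>F\<bar> + 1"
  define T where "T = (LINT x|unit_measure. g x * weak_deriv \<phi> x)
      - (a * \<phi> p + b * \<phi> q + (LINT x|unit_measure. f x * \<phi> x))"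
  have C: "C > 0" unfolding C_def by linarith
  have "\<bar>T\<bar> \<le> 0 + e" if "e > 0" for e
  proof -
    have "e / C > 0" using that C by simp
    from H01_approx[OF \<phi> this] obtain \<psi> where \<psi>: "\<psi> \<in> Cc1"
        and wd: "has_weak_deriv (\<lambda>x. \<phi> x - \<psi> x) (\<lambda>x. weak_deriv \<phi> x - deriv \<psi> x)"
      and small: "(LINT x|unit_measure. \<bar>weak_deriv \<phi> x - deriv \<psi> x\<bar>) < e / C" .
    define \<epsilon> where "\<epsilon> = (LINT x|unit_measure. \<bar>weak_deriv \<phi> x - deriv \<psi> x\<bar>)"
    have e0: "\<epsilon> \<ge> 0" unfolding \<epsilon>_def by (intro Bochner_Integration.integral_nonneg) simp
    have sup: "\<bar>\<phi> x - \<psi> x\<bar> \<le> \<epsilon>" if "x \<in> {0..1}" for x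
      unfolding \<epsilon>_def by (rule H01_approx_sup[OF \<phi> \<psi> that wd])
    have wi: "integrable unit_measure (weak_deriv \<phi>)"
      using H01_has_weak_deriv[OF \<phi>] by (intro L2_integrable has_weak_deriv_L2)
    have pi: "integrable unit_measure (deriv \<psi>)" using \<psi> by (intro L2_integrable Cc1_L2)
    have i: "integrable unit_measure (\<lambda>x. g x * weak_deriv \<phi> x)" "integrable unit_measure (\<lambda>x. g x * deriv \<psi> x)"
      by (rule integral_abs_le_sup(1)[OF g wi], assumption) (rule integral_abs_le_sup(1)[OF g pi], assumption)
    have fi: "integrable unit_measure (\<lambda>x. f x * \<phi> x)" "integrable unit_measure (\<lambda>x. f x * \<psi> x)"
      by (intro continuous_on_unit_integrable continuous_on_mult f H01_continuous_on \<phi> Cc1_continuous_on \<psi>)+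
    have "T = (LINT x|unit_measure. g x * (weak_deriv \<phi> x - deriv \<psi> x))
        - (a * (\<phi> p - \<psi> p) + b * (\<phi> q - \<psi> q) + (LINT x|unit_measure. f x * (\<phi> x - \<psi> x)))"
      unfolding T_def using i fi eq[OF \<psi>] by (simp add: right_diff_distrib)
    moreover have "\<bar>LINT x|unit_measure. g x * (weak_deriv \<phi> x - deriv \<psi> x)\<bar> \<le> M * \<epsilon>"
      unfolding \<epsilon>_def using g wi pi by (intro integral_abs_le_sup Bochner_Integration.integrable_diff) auto
    moreover have "\<bar>a * (\<phi> p - \<psi> p)\<bar> \<le> \<bar>a\<bar> * \<epsilon>" "\<bar>b * (\<phi> q - \<psi> q)\<bar> \<le> \<bar>b\<bar> * \<epsilon>"
      unfolding abs_mult using sup pq by (intro mult_left_mono; auto)+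
    moreover have "\<bar>LINT x|unit_measure. f x * (\<phi> x - \<psi> x)\<bar> \<le> F * \<epsilon>"
    proof -
      have "\<bar>LINT x|unit_measure. f x * (\<phi> x - \<psi> x)\<bar> \<le> (LINT x|unit_measure. \<bar>f x * (\<phi> x - \<psi> x)\<bar>)"
        by (rule integral_abs_bound)
      also have "\<dots> \<le> (LINT x|unit_measure. F * \<epsilon>)"
      proof (intro integral_mono integrable_abs)
        show "integrable unit_measure (\<lambda>x. f x * (\<phi> x - \<psi> x))" using fi by (simp add: right_diff_distrib)
        show "integrable unit_measure (\<lambda>x. F * \<epsilon>)" by (rule L2_integrable[OF L2_const])
        show "\<bar>f x * (\<phi> x - \<psi> x)\<bar> \<le> F * \<epsilon>" if "x \<in> space unit_measure" for x
          unfolding abs_mult using that F[of x] sup[of x] by (intro mult_mono) auto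
      qed
      finally show ?thesis by (simp add: measure_restrict_space)
    qed
    moreover have "M * \<epsilon> + \<bar>a\<bar> * \<epsilon> + \<bar>b\<bar> * \<epsilon> + F * \<epsilon> \<le> C * \<epsilon>"
      unfolding C_def using e0 mult_right_mono[OF abs_ge_self[of M] e0] mult_right_mono[OF abs_ge_self[of F] e0]
      by (simp add: distrib_right)
    moreover have "C * \<epsilon> \<le> e" using small C unfolding \<epsilon>_def by (simp add: field_simps)
    ultimately show ?thesis by linarith
  qed
  then have "\<bar>T\<bar> \<le> 0" by (rule field_le_epsilon)
  then show ?thesis by (simp add: T_def)
qed

section \<open>The shooting function\<close>

definition sn :: "real \<Rightarrow> real \<Rightarrow> real" where
  "sn \<mu> t = (if \<mu> > 0 then sin (sqrt \<mu> * t) / sqrt \<mu>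
     else if \<mu> < 0 then sinh (sqrt (- \<mu>) * t) / sqrt (- \<mu>) else t)"

definition cs :: "real \<Rightarrow> real \<Rightarrow> real" where
  "cs \<mu> t = (if \<mu> > 0 then cos (sqrt \<mu> * t)
     else if \<mu> < 0 then cosh (sqrt (- \<mu>) * t) else 1)"

lemma sn_0 [simp]: "sn \<mu> 0 = 0" by (simp add: sn_def)

lemma cs_0 [simp]: "cs \<mu> 0 = 1" by (simp add: cs_def)

lemma DERIV_sn: "(sn \<mu> has_real_derivative cs \<mu> t) (at t)"
proof -
  have "((\<lambda>t. sin (r * t) / r) has_real_derivative cos (r * t)) (at t)"
      "((\<lambda>t. sinh (r * t) / r) has_real_derivative cosh (r * t)) (at t)" if "r \<noteq> 0" for r :: real
    using that by (auto intro!: derivative_eq_intros)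
  from this[of "sqrt \<mu>"] this[of "sqrt (- \<mu>)"] show ?thesis
    by (cases \<mu> "0::real" rule: linorder_cases) (simp_all add: sn_def[abs_def] cs_def)
qed

lemma DERIV_cs: "(cs \<mu> has_real_derivative - \<mu> * sn \<mu> t) (at t)"
proof -
  have neg: "- \<mu> / sqrt (- \<mu>) = sqrt (- \<mu>)" if "\<mu> < 0" using real_div_sqrt[of "- \<mu>"] that by simp
  have pos: "\<mu> / sqrt \<mu> = sqrt \<mu>" if "\<mu> > 0" using real_div_sqrt[of "\<mu>"] that by simp
  consider "\<mu> > 0" | "\<mu> < 0" | "\<mu> = 0" by linarith
  then show ?thesis
  proof cases
    case 1
    have "((\<lambda>t. cos (sqrt \<mu> * t)) has_real_derivative - sin (sqrt \<mu> * t) * (\<mu> / sqrt \<mu>)) (at t)"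
      unfolding pos[OF 1] by (auto intro!: derivative_eq_intros)
    then show ?thesis using 1 by (simp add: sn_def cs_def[abs_def] mult_ac)
  next
    case 2
    have "((\<lambda>t. cosh (sqrt (- \<mu>) * t)) has_real_derivative sinh (sqrt (- \<mu>) * t) * (- \<mu> / sqrt (- \<mu>))) (at t)"
      unfolding neg[OF 2] by (auto intro!: derivative_eq_intros)
    then show ?thesis using 2 by (simp add: sn_def cs_def[abs_def] mult_ac)
  qed (simp add: sn_def cs_def[abs_def])
qed

lemma cs_sn_identity: "(cs \<mu> t)\<^sup>2 + \<mu> * (sn \<mu> t)\<^sup>2 = 1"
proof -
  consider "\<mu> > 0" | "\<mu> < 0" | "\<mu> = 0" by linarith
  then show ?thesis
  proof cases
    case 2
    then show ?thesis using cosh_square_eq[of "sqrt (- \<mu>) * t"]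
      by (simp add: sn_def cs_def power_divide)
  qed (auto simp: sn_def cs_def power_divide)
qed

lemma sn_add: "sn \<mu> (a + b) = sn \<mu> a * cs \<mu> b + cs \<mu> a * sn \<mu> b"
  by (auto simp: sn_def cs_def sin_add sinh_add distrib_left add_divide_distrib)

lemma cs_add: "cs \<mu> (a + b) = cs \<mu> a * cs \<mu> b - \<mu> * sn \<mu> a * sn \<mu> b"
  by (auto simp: sn_def cs_def cos_add cosh_add distrib_left)

text \<open>Variation of constants: two combinations of \<open>Z\<close> and \<open>Z'\<close> with
  \<open>sn\<close> and \<open>cs\<close> have derivative 0 and start at 0. They form a linear
  system for \<open>Z t\<close> and \<open>Z' t\<close> of determinant
  \<open>(cs \<mu> t)\<^sup>2 + \<mu> * (sn \<mu> t)\<^sup>2 = 1\<close>.\<close>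

lemma ode_unique:
  fixes Z Z' :: "real \<Rightarrow> real"
  assumes Z: "\<And>t. t \<in> {0..b} \<Longrightarrow> (Z has_real_derivative Z' t) (at t within {0..b})"
    and Z': "\<And>t. t \<in> {0..b} \<Longrightarrow> (Z' has_real_derivative - \<mu> * Z t) (at t within {0..b})"
    and 0: "Z 0 = 0" "Z' 0 = 0" and t: "t \<in> {0..b}"
  shows "Z t = 0"
proof -
  note sc = has_field_derivative_at_within[OF DERIV_sn] has_field_derivative_at_within[OF DERIV_cs]
  have "((\<lambda>t. Z t * cs \<mu> t - Z' t * sn \<mu> t) has_real_derivative 0) (at t within {0..b})" if "t \<in> {0..b}" for t
    by (rule DERIV_cong[OF DERIV_diff[OF DERIV_mult[OF Z[OF that] sc(2)] DERIV_mult[OF Z'[OF that] sc(1)]]])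
      (simp add: algebra_simps)
  then obtain c1 where c1: "\<And>t. t \<in> {0..b} \<Longrightarrow> Z t * cs \<mu> t - Z' t * sn \<mu> t = c1"
    using has_field_derivative_zero_constant[of "{0..b}" "\<lambda>t. Z t * cs \<mu> t - Z' t * sn \<mu> t"] by auto
  have "((\<lambda>t. \<mu> * (Z t * sn \<mu> t) + Z' t * cs \<mu> t) has_real_derivative 0) (at t within {0..b})" if "t \<in> {0..b}" for t
    by (rule DERIV_cong[OF DERIV_add[OF DERIV_cmult[OF DERIV_mult[OF Z[OF that] sc(1)]] DERIV_mult[OF Z'[OF that] sc(2)]]])
      (simp add: algebra_simps)
  then obtain c2 where c2: "\<And>t. t \<in> {0..b} \<Longrightarrow> \<mu> * (Z t * sn \<mu> t) + Z' t * cs \<mu> t = c2"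
    using has_field_derivative_zero_constant[of "{0..b}" "\<lambda>t. \<mu> * (Z t * sn \<mu> t) + Z' t * cs \<mu> t"] by auto
  have "0 \<in> {0..b}" using t by auto
  with c1[of 0] c2[of 0] 0 have "c1 = 0" "c2 = 0" by auto
  with c1[OF t] c2[OF t] have e: "Z t * cs \<mu> t - Z' t * sn \<mu> t = 0" "\<mu> * (Z t * sn \<mu> t) + Z' t * cs \<mu> t = 0" by auto
  have "Z t * ((cs \<mu> t)\<^sup>2 + \<mu> * (sn \<mu> t)\<^sup>2)
      = cs \<mu> t * (Z t * cs \<mu> t - Z' t * sn \<mu> t) + sn \<mu> t * (\<mu> * (Z t * sn \<mu> t) + Z' t * cs \<mu> t)"
    by (simp add: algebra_simps power2_eq_square)
  then show ?thesis using e by (simp add: cs_sn_identity)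
qed

text \<open>\<open>shoot \<mu>\<close> solves the equation with \<open>y 0 = 0\<close>, \<open>y' 0 = 1\<close>; each point mass produces a jump
  \<open>- 12 y\<close> of the derivative.\<close>

definition sn_pos :: "real \<Rightarrow> real \<Rightarrow> real" where
  "sn_pos \<mu> t = (if t \<ge> 0 then sn \<mu> t else 0)"

definition y1 :: "real \<Rightarrow> real" where "y1 \<mu> = sn \<mu> (1/3)"

definition y2 :: "real \<Rightarrow> real" where "y2 \<mu> = sn \<mu> (2/3) - 12 * y1 \<mu> * sn \<mu> (1/3)"

definition shoot :: "real \<Rightarrow> real \<Rightarrow> real" where
  "shoot \<mu> x = sn \<mu> x - 12 * y1 \<mu> * sn_pos \<mu> (x - 1/3) - 12 * y2 \<mu> * sn_pos \<mu> (x - 2/3)"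

lemma shoot_0: "shoot \<mu> 0 = 0" by (simp add: shoot_def sn_pos_def)

lemma shoot_third: "shoot \<mu> (1/3) = y1 \<mu>" "shoot \<mu> (2/3) = y2 \<mu>"
  by (simp_all add: shoot_def sn_pos_def y1_def y2_def)

text \<open>Put \<kappa> = 2 \<gamma> - 12 \<sigma>. At equidistant nodes y(n+1) + y(n-1) = \<kappa>
  y(n), the term 12 \<sigma> coming from the jump of the slope. From y(0) = 0 and y(1) = \<sigma>
  this gives y(2) = \<kappa> \<sigma> and y(3) = \<sigma> (\<kappa>^2 - 1). The root \<sigma> = 0
  means that the solution vanishes at both masses; \<kappa> = 1 and \<kappa> = -1 give equal and
  opposite values there. The proof checks the product with the addition formulas.\<close>

lemma shoot_1: "shoot \<mu> 1 = sn \<mu> (1/3) * (2 * cs \<mu> (1/3) - 12 * sn \<mu> (1/3) - 1) * (2 * cs \<mu> (1/3) - 12 * sn \<mu> (1/3) + 1)"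
proof -
  define s c where "s = sn \<mu> (1/3)" and "c = cs \<mu> (1/3)"
  have s2: "sn \<mu> (2/3) = 2 * s * c" using sn_add[of \<mu> "1/3" "1/3"] by (simp add: s_def c_def)
  have c2: "cs \<mu> (2/3) = c\<^sup>2 - \<mu> * s\<^sup>2" using cs_add[of \<mu> "1/3" "1/3"] by (simp add: s_def c_def power2_eq_square)
  have "sn \<mu> 1 = sn \<mu> (2/3) * c + cs \<mu> (2/3) * s" using sn_add[of \<mu> "2/3" "1/3"] by (simp add: s_def c_def)
  also have "\<dots> = 2 * s * c * c + (2 * c\<^sup>2 - 1) * s"
    unfolding s2 c2 using cs_sn_identity[of \<mu> "1/3"] by (simp add: s_def c_def)
  finally have s3: "sn \<mu> 1 = 2 * s * c * c + (2 * c\<^sup>2 - 1) * s" .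
  show ?thesis
    unfolding shoot_def sn_pos_def y2_def y1_def using s2 s3
    by (simp add: s_def[symmetric] c_def[symmetric] algebra_simps power2_eq_square)
qed

text \<open>The ramps cancel the slope jumps of \<open>shoot\<close>, so \<open>lift\<close> is C1
  across the masses and its second derivative is \<open>- \<mu> * shoot \<mu> x\<close> at every
  point.\<close>

definition lift :: "real \<Rightarrow> real \<Rightarrow> real" where
  "lift \<mu> x = shoot \<mu> x + 12 * y1 \<mu> * ramp (x - 1/3) + 12 * y2 \<mu> * ramp (x - 2/3)"

definition lift' :: "real \<Rightarrow> real \<Rightarrow> real" where
  "lift' \<mu> x = cs \<mu> x - 12 * y1 \<mu> * (if x - 1/3 \<ge> 0 then cs \<mu> (x - 1/3) - 1 else 0)
     - 12 * y2 \<mu> * (if x - 2/3 \<ge> 0 then cs \<mu> (x - 2/3) - 1 else 0)"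

lemma DERIV_shift: "(f has_real_derivative D) (at (x - p)) \<Longrightarrow> ((\<lambda>x. f (x - p)) has_real_derivative D) (at x)"
  for p :: real
  using DERIV_shift[of f D x "- p"] by simp

lemma DERIV_lift: "(lift \<mu> has_real_derivative lift' \<mu> x) (at x)"
proof -
  \<comment> \<open>Subtracting \<open>t\<close> makes the function vanish together with its
    derivative at 0, as gluing with zero requires; this is the effect of the ramps in
    \<open>lift\<close>.\<close>
  have e: "((\<lambda>t. if t \<ge> 0 then sn \<mu> t - t else 0) has_real_derivative (if t \<ge> 0 then cs \<mu> t - 1 else 0)) (at t)" for t
    by (rule DERIV_pos_part) (auto intro!: DERIV_diff DERIV_sn DERIV_ident)
  have "((\<lambda>x. sn \<mu> x - 12 * y1 \<mu> * (if x - 1/3 \<ge> 0 then sn \<mu> (x - 1/3) - (x - 1/3) else 0)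
     - 12 * y2 \<mu> * (if x - 2/3 \<ge> 0 then sn \<mu> (x - 2/3) - (x - 2/3) else 0)) has_real_derivative lift' \<mu> x) (at x)"
    unfolding lift'_def by (intro DERIV_diff DERIV_cmult DERIV_sn DERIV_shift[OF e])
  then show ?thesis
    by (rule has_field_derivative_transform_within_open[of _ _ _ UNIV])
      (auto simp: lift_def shoot_def sn_pos_def ramp_def algebra_simps)
qed

lemma DERIV_lift': "(lift' \<mu> has_real_derivative - \<mu> * shoot \<mu> x) (at x)"
proof -
  have e: "((\<lambda>t. if t \<ge> 0 then cs \<mu> t - 1 else 0) has_real_derivative (if t \<ge> 0 then - \<mu> * sn \<mu> t - 0 else 0)) (at t)" for t
    by (rule DERIV_pos_part[OF DERIV_diff[OF DERIV_cs DERIV_const]]) simp_all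
  have "(lift' \<mu> has_real_derivative - \<mu> * sn \<mu> x
     - 12 * y1 \<mu> * (if x - 1/3 \<ge> 0 then - \<mu> * sn \<mu> (x - 1/3) - 0 else 0)
     - 12 * y2 \<mu> * (if x - 2/3 \<ge> 0 then - \<mu> * sn \<mu> (x - 2/3) - 0 else 0)) (at x)"
    unfolding lift'_def[abs_def] by (intro DERIV_diff DERIV_cmult DERIV_cs DERIV_shift[OF e])
  then show ?thesis
    by (rule DERIV_cong) (auto simp: shoot_def sn_pos_def algebra_simps)
qed

lemma continuous_on_lift': "continuous_on S (lift' \<mu>)"
  by (rule DERIV_continuous_on) (rule has_field_derivative_at_within[OF DERIV_lift'])

lemma continuous_on_shoot: "continuous_on S (shoot \<mu>)"
proof -
  have "continuous_on S (lift \<mu>)"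
    by (rule DERIV_continuous_on) (rule has_field_derivative_at_within[OF DERIV_lift])
  then have "continuous_on S (\<lambda>x. lift \<mu> x - 12 * y1 \<mu> * ramp (x - 1/3) - 12 * y2 \<mu> * ramp (x - 2/3))"
    by (intro continuous_intros)
  then show ?thesis by (rule continuous_on_eq) (simp add: lift_def)
qed

section \<open>Eigenfunctions\<close>

definition heav :: "real \<Rightarrow> real" where "heav t = (if t \<ge> 0 then 1 else 0)"

lemma DERIV_ramp:
  assumes "t \<noteq> 0"
  shows "(ramp has_real_derivative heav t) (at t)" "isCont heav t"
proof -
  consider "t > 0" | "t < 0" using assms by linarith
  then have "(ramp has_real_derivative heav t) (at t) \<and> (heav has_real_derivative 0) (at t)"
  proof cases
    case 1
    have "(ramp has_real_derivative 1) (at t)"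
      by (rule has_field_derivative_transform_within_open[OF DERIV_ident, of "{0<..}"]) (use 1 in \<open>auto simp: ramp_def\<close>)
    moreover have "(heav has_real_derivative 0) (at t)"
      by (rule has_field_derivative_transform_within_open[OF DERIV_const[of 1], of "{0<..}"]) (use 1 in \<open>auto simp: heav_def\<close>)
    ultimately show ?thesis using 1 by (simp add: heav_def)
  next
    case 2
    have "(ramp has_real_derivative 0) (at t)"
      by (rule has_field_derivative_transform_within_open[OF DERIV_const[of 0], of "{..<0}"]) (use 2 in \<open>auto simp: ramp_def\<close>)
    moreover have "(heav has_real_derivative 0) (at t)"
      by (rule has_field_derivative_transform_within_open[OF DERIV_const[of 0], of "{..<0}"]) (use 2 in \<open>auto simp: heav_def\<close>)
    ultimately show ?thesis using 2 by (simp add: heav_def)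
  qed
  then show "(ramp has_real_derivative heav t) (at t)" "isCont heav t"
    by (auto intro: DERIV_isCont)
qed

lemma isCont_heav_shift: "x \<noteq> p \<Longrightarrow> isCont (\<lambda>x. heav (x - p)) x"
  by (rule isCont_o2[where g = heav]) (auto intro: DERIV_ramp)

lemma DERIV_ramp_shift: "x \<noteq> p \<Longrightarrow> ((\<lambda>x. ramp (x - p)) has_real_derivative heav (x - p)) (at x)"
  by (intro DERIV_shift DERIV_ramp) auto

lemma heav_measurable: "heav \<in> borel_measurable borel"
  unfolding heav_def[abs_def] by measurable

lemma integral_mult_heav:
  assumes "integrable unit_measure f" "0 \<le> p" "p \<le> 1"
  shows "integrable unit_measure (\<lambda>x. heav (x - p) * f x)"
    "(LINT x|unit_measure. heav (x - p) * f x) = integral {0..1} f - integral {0..p} f"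
proof -
  have *: "heav (x - p) * f x = indicat_real {p..1} x * f x" if "x \<in> space unit_measure" for x
    using that by (auto simp: heav_def indicator_def)
  show "integrable unit_measure (\<lambda>x. heav (x - p) * f x)"
    using integral_unit_Icc(1)[OF assms(1,2), of 1]
    by (subst Bochner_Integration.integrable_cong[OF refl *]) auto
  have "(LINT x|unit_measure. heav (x - p) * f x) = integral {p..1} f"
    using integral_unit_Icc(2)[OF assms(1,2), of 1]
    by (subst Bochner_Integration.integral_cong[OF refl *]) auto
  moreover have "integral {0..p} f + integral {p..1} f = integral {0..1} f"
    using assms by (intro Henstock_Kurzweil_Integration.integral_combine integral_unit) auto
  ultimately show "(LINT x|unit_measure. heav (x - p) * f x) = integral {0..1} f - integral {0..p} f" by simp
qed

text \<open>By the fundamental theorem the primitive of \<open>f\<close> is \<open>F\<close> itself,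
  and \<open>F 1 = 0\<close> provides the zero mean.\<close>

lemma H01_piecewise_C1:
  fixes F f :: "real \<Rightarrow> real"
  assumes P: "finite P" and F: "continuous_on {0..1} F" "F 0 = 0" "F 1 = 0"
    and f: "\<And>x. x \<in> {0<..<1} - P \<Longrightarrow> (F has_real_derivative f x) (at x)"
      "\<And>x. x \<in> {0<..<1} - P \<Longrightarrow> isCont f x"
      "\<And>x. x \<in> {0..1} \<Longrightarrow> \<bar>f x\<bar> \<le> M"
  shows "(\<lambda>x. if x \<in> {0..1} then F x else 0) \<in> H01"
    "has_weak_deriv (\<lambda>x. if x \<in> {0..1} then F x else 0) (\<lambda>x. if x \<in> {0..1} then f x else 0)"
proof -
  define g where "g x = (if x \<in> {0..1} then f x else 0)" for x
  have int: "(g has_integral F x) {0..x}" if "x \<in> {0..1}" for x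
  proof -
    have "(f has_integral F x - F 0) {0..x}"
      using that f(1) P
      by (intro fundamental_theorem_of_calculus_interior_strong[of P] continuous_on_subset[OF F(1)])
        (auto simp: has_real_derivative_iff_has_vector_derivative)
    then show ?thesis using that F(2) by (subst has_integral_cong[of _ g f]) (auto simp: g_def)
  qed
  interpret piecewise_continuous "insert 0 (insert 1 P)" g M
  proof
    show "\<bar>g x\<bar> \<le> M" for x using f(3)[of x] f(3)[of 0] by (auto simp: g_def)
    show "isCont g x" if "x \<notin> insert 0 (insert 1 P)" for x
    proof (cases "x \<in> {0..1}")
      case True
      then have "x \<in> {0<..<1}" using that by auto
      then have "eventually (\<lambda>y. g y = f y) (nhds x)"
        using eventually_nhds_in_open[of "{0<..<1}" x] by (auto simp: g_def elim!: eventually_mono)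
      then show ?thesis using f(2)[of x] \<open>x \<in> {0<..<1}\<close> that by (subst isCont_cong) auto
    next
      case False
      then have "eventually (\<lambda>y. g y = 0) (nhds x)"
        using eventually_nhds_in_open[OF open_Compl[OF closed_atLeastAtMost], of x 0 1] by (auto simp: g_def elim!: eventually_mono)
      then show ?thesis by (subst isCont_cong) auto
    qed
    show "integral {0..1} g = 0" using int[of 1] F(3) by (simp add: integral_unique)
  qed (use P in \<open>auto simp: g_def\<close>)
  have "u = (\<lambda>x. if x \<in> {0..1} then F x else 0)"
    using int by (auto simp: u_def integral_unique)
  then show "(\<lambda>x. if x \<in> {0..1} then F x else 0) \<in> H01"
    "has_weak_deriv (\<lambda>x. if x \<in> {0..1} then F x else 0) (\<lambda>x. if x \<in> {0..1} then f x else 0)"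
    using u_H01 has_weak_deriv_u unfolding g_def[abs_def] by auto
qed

section \<open>Weak solutions are the multiples of the shooting solution\<close>

lemma is_solution_iff:
  "is_solution \<mu> U \<longleftrightarrow> U \<in> H01 \<and> (\<forall>\<phi>\<in>H01. (LINT x|unit_measure. weak_deriv U x * weak_deriv \<phi> x)
     = 12 * (U (1/3) * \<phi> (1/3) + U (2/3) * \<phi> (2/3)) + \<mu> * (LINT x|unit_measure. U x * \<phi> x))"
  unfolding is_solution_def eq_Hm1_def dist_deriv_def delta_mult_def L2_functional_def by auto

text \<open>The derivative of \<open>shoot\<close> is a C1 part plus two jumps. Integration by parts
  of \<open>lift'\<close> yields the term with \<mu>, and each \<open>heav (x - p)\<close> paired
  with \<open>deriv \<psi>\<close> yields \<open>- \<psi> p\<close>, the point mass.\<close>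

lemma shoot_weak_identity:
  assumes \<psi>: "\<psi> \<in> Cc1"
  shows "(LINT x|unit_measure. (lift' \<mu> x - 12 * y1 \<mu> * heav (x - 1/3) - 12 * y2 \<mu> * heav (x - 2/3)) * deriv \<psi> x)
    = 12 * y1 \<mu> * \<psi> (1/3) + 12 * y2 \<mu> * \<psi> (2/3) + (LINT x|unit_measure. (\<mu> * shoot \<mu> x) * \<psi> x)"
proof -
  have d: "integrable unit_measure (deriv \<psi>)" using \<psi> by (intro L2_integrable Cc1_L2)
  have i1: "integrable unit_measure (\<lambda>x. lift' \<mu> x * deriv \<psi> x)" "integrable unit_measure (\<lambda>x. (\<mu> * shoot \<mu> x) * \<psi> x)"
    by (intro continuous_on_unit_integrable continuous_on_mult continuous_on_const continuous_on_lift' continuous_on_shoot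
        Cc1_deriv_continuous_on Cc1_continuous_on \<psi>)+
  have FTC: "integral {0..p} (deriv \<psi>) = \<psi> p" if "p \<in> {0..1}" for p
    using weak_deriv_integral[OF Cc1_has_weak_deriv[OF \<psi>] Cc1_continuous_on[OF \<psi>] that] Cc1_outside[OF \<psi>, of 0] by simp
  have h: "integrable unit_measure (\<lambda>x. heav (x - p) * deriv \<psi> x)"
      "(LINT x|unit_measure. heav (x - p) * deriv \<psi> x) = - \<psi> p" if "p \<in> {0..1}" for p
    using integral_mult_heav[OF d, of p] that FTC[OF that] FTC[of 1] Cc1_outside[OF \<psi>, of 1] by auto
  have "(LINT x|unit_measure. lift' \<mu> x * deriv \<psi> x - (\<mu> * shoot \<mu> x) * \<psi> x) = lift' \<mu> 1 * \<psi> 1 - lift' \<mu> 0 * \<psi> 0"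
  proof (rule integral_unit_FTC[of "{}"])
    show "continuous_on {0..1} (\<lambda>x. lift' \<mu> x * \<psi> x)"
      by (intro continuous_on_mult continuous_on_lift' Cc1_continuous_on \<psi>)
    show "((\<lambda>x. lift' \<mu> x * \<psi> x) has_real_derivative lift' \<mu> x * deriv \<psi> x - (\<mu> * shoot \<mu> x) * \<psi> x) (at x)" for x
      by (rule DERIV_cong[OF DERIV_mult[OF DERIV_lift' Cc1_DERIV[OF \<psi>]]]) simp
  qed (use i1 in auto)
  then have "(LINT x|unit_measure. lift' \<mu> x * deriv \<psi> x) = (LINT x|unit_measure. (\<mu> * shoot \<mu> x) * \<psi> x)"
    using i1 Cc1_outside[OF \<psi>] by simp
  moreover have "(LINT x|unit_measure. (lift' \<mu> x - 12 * y1 \<mu> * heav (x - 1/3) - 12 * y2 \<mu> * heav (x - 2/3)) * deriv \<psi> x)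
     = (LINT x|unit_measure. lift' \<mu> x * deriv \<psi> x - 12 * y1 \<mu> * (heav (x - 1/3) * deriv \<psi> x) - 12 * y2 \<mu> * (heav (x - 2/3) * deriv \<psi> x))"
    by (simp add: algebra_simps)
  moreover have "\<dots> = (LINT x|unit_measure. lift' \<mu> x * deriv \<psi> x) + 12 * y1 \<mu> * \<psi> (1/3) + 12 * y2 \<mu> * \<psi> (2/3)"
    using i1(1) h[of "1/3"] h[of "2/3"] by simp
  ultimately show ?thesis by simp
qed

text \<open>\<open>shoot \<mu> 1 = 0\<close> supplies the second boundary value needed for
  membership in \<open>H01\<close>. The weak identity for test functions then extends to
  \<open>H01\<close>, the derivative of \<open>shoot\<close> being bounded.\<close>

lemma shoot_is_solution:
  assumes "shoot \<mu> 1 = 0"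
  shows "is_solution \<mu> (\<lambda>x. if x \<in> {0..1} then A * shoot \<mu> x else 0)"
proof -
  define f where "f x = lift' \<mu> x - 12 * y1 \<mu> * heav (x - 1/3) - 12 * y2 \<mu> * heav (x - 2/3)" for x
  define U where "U x = (if x \<in> {0..1} then A * shoot \<mu> x else 0)" for x
  have "bounded (lift' \<mu> ` {0..1})"
    by (intro compact_imp_bounded compact_continuous_image continuous_on_lift') auto
  then obtain B where B: "\<And>x. x \<in> {0..1} \<Longrightarrow> \<bar>lift' \<mu> x\<bar> \<le> B" unfolding bounded_iff by fastforce
  define M where "M = B + \<bar>12 * y1 \<mu>\<bar> + \<bar>12 * y2 \<mu>\<bar>"
  have bound: "\<bar>f x\<bar> \<le> M" if "x \<in> {0..1}" for x
    using B[OF that] by (auto simp: f_def M_def heav_def)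
  have D: "(shoot \<mu> has_real_derivative f x) (at x)" if "x \<noteq> 1/3" "x \<noteq> 2/3" for x
  proof -
    have "((\<lambda>x. lift \<mu> x - 12 * y1 \<mu> * ramp (x - 1/3) - 12 * y2 \<mu> * ramp (x - 2/3)) has_real_derivative f x) (at x)"
      unfolding f_def using that by (intro DERIV_diff DERIV_cmult DERIV_lift DERIV_ramp_shift) auto
    then show ?thesis by (simp add: lift_def)
  qed
  have cont: "isCont f x" if "x \<noteq> 1/3" "x \<noteq> 2/3" for x
    unfolding f_def using that
    by (intro isCont_diff isCont_mult continuous_const isCont_heav_shift DERIV_isCont[OF DERIV_lift']) auto
  have UH: "U \<in> H01" "has_weak_deriv U (\<lambda>x. if x \<in> {0..1} then A * f x else 0)"
  proof -
    have "\<bar>A * f x\<bar> \<le> \<bar>A\<bar> * M" if "x \<in> {0..1}" for x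
      unfolding abs_mult using bound[OF that] by (intro mult_left_mono) auto
    moreover have "continuous_on {0..1} (\<lambda>x. A * shoot \<mu> x)" by (intro continuous_intros continuous_on_shoot)
    ultimately show "U \<in> H01" "has_weak_deriv U (\<lambda>x. if x \<in> {0..1} then A * f x else 0)"
      unfolding U_def[abs_def] using assms shoot_0 D cont
        H01_piecewise_C1[of "{1/3, 2/3}" "\<lambda>x. A * shoot \<mu> x" "\<lambda>x. A * f x" "\<bar>A\<bar> * M"]
      by (auto intro!: DERIV_cmult isCont_mult)
  qed
  have fm: "f \<in> borel_measurable unit_measure"
    unfolding f_def
    by (intro borel_measurable_diff borel_measurable_times continuous_on_unit_measurable[OF continuous_on_lift'] borel_measurable_const
        borel_imp_unit_measurable measurable_compose[OF _ heav_measurable]) auto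
  have "(LINT x|unit_measure. weak_deriv U x * weak_deriv \<phi> x)
     = 12 * (U (1/3) * \<phi> (1/3) + U (2/3) * \<phi> (2/3)) + \<mu> * (LINT x|unit_measure. U x * \<phi> x)" if \<phi>: "\<phi> \<in> H01" for \<phi>
  proof -
    have "(LINT x|unit_measure. weak_deriv U x * weak_deriv \<phi> x) = (LINT x|unit_measure. weak_deriv \<phi> x * weak_deriv U x)"
      by (simp add: mult.commute)
    also have "\<dots> = (LINT x|unit_measure. weak_deriv \<phi> x * (if x \<in> {0..1} then A * f x else 0))"
      using L2_measurable[OF has_weak_deriv_L2[OF H01_has_weak_deriv[OF \<phi>]]] by (rule integral_mult_weak_deriv[OF UH(2)])
    also have "\<dots> = (LINT x|unit_measure. A * (f x * weak_deriv \<phi> x))"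
      by (intro Bochner_Integration.integral_cong) auto
    also have "\<dots> = A * (LINT x|unit_measure. f x * weak_deriv \<phi> x)" by simp
    also have "(LINT x|unit_measure. f x * weak_deriv \<phi> x)
        = 12 * y1 \<mu> * \<phi> (1/3) + 12 * y2 \<mu> * \<phi> (2/3) + (LINT x|unit_measure. (\<mu> * shoot \<mu> x) * \<phi> x)"
    proof (rule H01_weak_identity[OF fm, of M])
      show "continuous_on {0..1} (\<lambda>x. \<mu> * shoot \<mu> x)" by (intro continuous_intros continuous_on_shoot)
    qed (use bound \<phi> shoot_weak_identity in \<open>auto simp: f_def\<close>)
    also have "(LINT x|unit_measure. (\<mu> * shoot \<mu> x) * \<phi> x) = \<mu> * (LINT x|unit_measure. shoot \<mu> x * \<phi> x)"
      by (simp add: mult.assoc)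
    also have "A * (12 * y1 \<mu> * \<phi> (1/3) + 12 * y2 \<mu> * \<phi> (2/3) + \<mu> * (LINT x|unit_measure. shoot \<mu> x * \<phi> x))
      = 12 * (U (1/3) * \<phi> (1/3) + U (2/3) * \<phi> (2/3)) + \<mu> * (LINT x|unit_measure. A * (shoot \<mu> x * \<phi> x))"
      by (simp add: U_def shoot_third algebra_simps)
    also have "(LINT x|unit_measure. A * (shoot \<mu> x * \<phi> x)) = (LINT x|unit_measure. U x * \<phi> x)"
      by (intro Bochner_Integration.integral_cong) (auto simp: U_def)
    finally show ?thesis .
  qed
  then show ?thesis using UH(1) unfolding is_solution_iff U_def[abs_def] by blast
qed

text \<open>Testing with Green's function of \<open>- d\<^sup>2/dx\<^sup>2\<close> yields an integral equation for a solution.\<close>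

lemma solution_integral_equation:
  assumes sol: "is_solution \<mu> U"
  obtains A where "\<And>s. s \<in> {0..1} \<Longrightarrow> U s = A * s - 12 * U (1/3) * ramp (s - 1/3) - 12 * U (2/3) * ramp (s - 2/3)
     - \<mu> * (s * integral {0..s} U - integral {0..s} (\<lambda>t. t * U t))"
proof -
  have U: "U \<in> H01" using sol by (simp add: is_solution_iff)
  have Uc: "continuous_on {0..1} U" by (rule H01_continuous_on[OF U])
  have wU: "integrable unit_measure (weak_deriv U)"
    using L2_integrable[OF has_weak_deriv_L2[OF H01_has_weak_deriv[OF U]]] .
  define L where "L = (LINT t|unit_measure. U t * (1 - t))"
  \<comment> \<open>The coefficient of \<open>s\<close> once the Green's function is expanded; it is
    also the value for which the equation at \<open>s = 1\<close> reads
    \<open>U 1 = 0\<close>.\<close>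
  define A where "A = 12 * (U (1/3) * (2/3) + U (2/3) * (1/3)) + \<mu> * L"
  have ramp_int: "(LINT t|unit_measure. U t * ramp (s - t)) = s * integral {0..s} U - integral {0..s} (\<lambda>t. t * U t)"
    if "s \<in> {0..1}" for s
  proof -
    have c: "continuous_on {0..1} (\<lambda>t. s * U t - t * U t)" by (intro continuous_intros Uc)
    have "(LINT t|unit_measure. U t * ramp (s - t)) = (LINT t|unit_measure. indicat_real {0..s} t * (s * U t - t * U t))"
      using that by (intro Bochner_Integration.integral_cong) (auto simp: ramp_def indicator_def algebra_simps)
    also have "\<dots> = integral {0..s} (\<lambda>t. s * U t - t * U t)"
      using that by (intro integral_unit_Icc continuous_on_unit_integrable c) auto
    also have "\<dots> = integral {0..s} (\<lambda>t. s * U t) - integral {0..s} (\<lambda>t. t * U t)"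
      using that by (intro Henstock_Kurzweil_Integration.integral_diff integrable_continuous_real continuous_intros
          continuous_on_subset[OF Uc]) auto
    finally show ?thesis by simp
  qed
  have eq: "U s = A * s - 12 * U (1/3) * ramp (s - 1/3) - 12 * U (2/3) * ramp (s - 2/3)
     - \<mu> * (s * integral {0..s} U - integral {0..s} (\<lambda>t. t * U t))" if s: "s \<in> {0..1}" for s
  proof -
    consider "s = 0" | "s = 1" | "0 < s" "s < 1" using s by fastforce
    then show ?thesis
    proof cases
      case 1
      then show ?thesis using H01_0[OF U] by (simp add: ramp_def)
    next
      case 2
      have "L = (LINT t|unit_measure. U t * ramp (1 - t))"
        unfolding L_def by (intro Bochner_Integration.integral_cong) (auto simp: ramp_def)
      then have "L = integral {0..1} U - integral {0..1} (\<lambda>t. t * U t)" using ramp_int[of 1] by simp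
      then show ?thesis using 2 H01_1[OF U] by (simp add: A_def ramp_def)
    next
      case 3
      \<comment> \<open>Equal to \<open>min x s * (1 - max x s)\<close> on the unit interval. Its
        slope drops by 1 at \<open>s\<close>, so pairing its derivative with that of
        \<open>U\<close> returns \<open>U s\<close>.\<close>
      define hat where "hat x = (if x \<in> {0..1} then x * (1 - s) - ramp (x - s) else 0)" for x
      have hat: "hat \<in> H01" "has_weak_deriv hat (\<lambda>x. if x \<in> {0..1} then 1 - s - heav (x - s) else 0)"
      proof -
        have "((\<lambda>x. x * (1 - s) - ramp (x - s)) has_real_derivative 1 - s - heav (x - s)) (at x)" if "x \<noteq> s" for x
          by (rule DERIV_cong[OF DERIV_diff[OF DERIV_mult[OF DERIV_ident DERIV_const] DERIV_ramp_shift[OF that]]]) simp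
        moreover have "isCont (\<lambda>x. 1 - s - heav (x - s)) x" if "x \<noteq> s" for x
          by (intro isCont_diff continuous_const isCont_heav_shift that)
        moreover have "continuous_on {0..1} (\<lambda>x. x * (1 - s) - ramp (x - s))" by (intro continuous_intros)
        ultimately show "hat \<in> H01" "has_weak_deriv hat (\<lambda>x. if x \<in> {0..1} then 1 - s - heav (x - s) else 0)"
          unfolding hat_def[abs_def] using 3
            H01_piecewise_C1[of "{s}" "\<lambda>x. x * (1 - s) - ramp (x - s)" "\<lambda>x. 1 - s - heav (x - s)" 1]
          by (auto simp: ramp_def heav_def)
      qed
      \<comment> \<open>The Green's function is symmetric; this form displays its dependence on
        \<open>s\<close>, a linear part plus a ramp, which is what the integral equation
        collects.\<close>
      have hat': "hat p = s * (1 - p) - ramp (s - p)" if "p \<in> {0..1}" for p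
        using that by (auto simp: hat_def ramp_def algebra_simps)
      have "(LINT x|unit_measure. weak_deriv U x * weak_deriv hat x)
        = (LINT x|unit_measure. weak_deriv U x * (if x \<in> {0..1} then 1 - s - heav (x - s) else 0))"
        using borel_measurable_integrable[OF wU] by (rule integral_mult_weak_deriv[OF hat(2)])
      also have "\<dots> = (LINT x|unit_measure. (1 - s) * weak_deriv U x - heav (x - s) * weak_deriv U x)"
        by (intro Bochner_Integration.integral_cong) (auto simp: algebra_simps)
      also have "\<dots> = (1 - s) * (LINT x|unit_measure. weak_deriv U x) - (LINT x|unit_measure. heav (x - s) * weak_deriv U x)"
        using wU integral_mult_heav(1)[OF wU, of s] 3 by simp
      also have "\<dots> = U s"
        using integral_unit(1)[OF wU] integral_mult_heav(2)[OF wU, of s] 3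
          H01_integral[OF U, of 1] H01_integral[OF U, of s] H01_1[OF U] by simp
      finally have "U s = 12 * (U (1/3) * hat (1/3) + U (2/3) * hat (2/3)) + \<mu> * (LINT x|unit_measure. U x * hat x)"
        using sol hat(1) unfolding is_solution_iff by auto
      also have "(LINT x|unit_measure. U x * hat x) = (LINT x|unit_measure. s * (U x * (1 - x)) - U x * ramp (s - x))"
        by (intro Bochner_Integration.integral_cong) (auto simp: hat' algebra_simps)
      also have "\<dots> = (LINT x|unit_measure. s * (U x * (1 - x))) - (LINT x|unit_measure. U x * ramp (s - x))"
        by (intro Bochner_Integration.integral_diff continuous_on_unit_integrable continuous_intros Uc)
      also have "\<dots> = s * L - (s * integral {0..s} U - integral {0..s} (\<lambda>t. t * U t))"
        using ramp_int[OF s] by (simp add: L_def)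
      finally show ?thesis by (simp add: hat' A_def algebra_simps)
    qed
  qed
  show ?thesis by (rule that[OF eq])
qed

text \<open>\<open>W\<close> is the difference \<open>Z\<close> of \<open>U\<close> and
  \<open>A * shoot\<close> with the kinks removed. Left of the first mass \<open>W = Z\<close>, so
  uniqueness gives \<open>Z = 0\<close> up to and including 1/3. This kills the ramp at 1/3, hence
  \<open>W = Z\<close> up to 2/3, and the argument repeats there and on the whole interval.\<close>

lemma solution_is_shoot:
  assumes sol: "is_solution \<mu> U"
  obtains A where "U = (\<lambda>x. if x \<in> {0..1} then A * shoot \<mu> x else 0)"
proof -
  have U: "U \<in> H01" using sol by (simp add: is_solution_iff)
  have Uc: "continuous_on {0..1} U" by (rule H01_continuous_on[OF U])
  obtain A where A: "\<And>s. s \<in> {0..1} \<Longrightarrow> U s = A * s - 12 * U (1/3) * ramp (s - 1/3) - 12 * U (2/3) * ramp (s - 2/3)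
     - \<mu> * (s * integral {0..s} U - integral {0..s} (\<lambda>t. t * U t))"
    using solution_integral_equation[OF sol] by blast
  define Z where "Z x = U x - A * shoot \<mu> x" for x
  \<comment> \<open>Written with primitives of the continuous function \<open>U\<close>, so that it
    can be differentiated twice although \<open>U\<close> is not known to be differentiable.\<close>
  define W where "W s = A * s - \<mu> * (s * integral {0..s} U - integral {0..s} (\<lambda>t. t * U t)) - A * lift \<mu> s" for s
  define W' where "W' s = A - \<mu> * integral {0..s} U - A * lift' \<mu> s" for s
  have W: "W s = Z s + 12 * Z (1/3) * ramp (s - 1/3) + 12 * Z (2/3) * ramp (s - 2/3)" if "s \<in> {0..1}" for s
    using A[OF that] by (simp add: W_def Z_def lift_def shoot_third algebra_simps)
  have dI: "((\<lambda>s. integral {0..s} U) has_real_derivative U s) (at s within {0..1})"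
    and dJ: "((\<lambda>s. integral {0..s} (\<lambda>t. t * U t)) has_real_derivative s * U s) (at s within {0..1})" if "s \<in> {0..1}" for s
    using that by (intro integral_has_real_derivative continuous_intros Uc; simp)+
  have dW: "(W has_real_derivative W' s) (at s within {0..1})" if "s \<in> {0..1}" for s
    unfolding W_def[abs_def]
    by (rule DERIV_cong[OF DERIV_diff[OF DERIV_diff[OF DERIV_cmult[OF DERIV_ident]
      DERIV_cmult[OF DERIV_diff[OF DERIV_mult[OF DERIV_ident dI[OF that]] dJ[OF that]]]]
      DERIV_cmult[OF has_field_derivative_at_within[OF DERIV_lift]]]]) (simp add: W'_def algebra_simps)
  have dW': "(W' has_real_derivative - \<mu> * Z s) (at s within {0..1})" if "s \<in> {0..1}" for s
    unfolding W'_def[abs_def]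
    by (rule DERIV_cong[OF DERIV_diff[OF DERIV_diff[OF DERIV_const DERIV_cmult[OF dI[OF that]]]
      DERIV_cmult[OF has_field_derivative_at_within[OF DERIV_lift']]]]) (simp add: Z_def algebra_simps)
  have W0: "W 0 = 0" "W' 0 = 0" by (simp_all add: W_def W'_def lift_def lift'_def shoot_0 ramp_def)
  have step: "Z s = 0" if eq: "\<And>x. x \<in> {0..b} \<Longrightarrow> W x = Z x" and b: "b \<le> 1" and s: "s \<in> {0..b}" for b s
  proof -
    have "W s = 0"
    proof (rule ode_unique[of b W W' \<mu>])
      show "(W has_real_derivative W' t) (at t within {0..b})" if "t \<in> {0..b}" for t
        using dW[of t] that b by (auto intro: DERIV_subset)
      show "(W' has_real_derivative - \<mu> * W t) (at t within {0..b})" if "t \<in> {0..b}" for t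
        using dW'[of t] that b unfolding eq[OF that] by (auto intro: DERIV_subset)
    qed (use W0 s in auto)
    then show ?thesis using eq[OF s] by simp
  qed
  have Z1: "Z (1/3) = 0" by (rule step[of "1/3"]) (auto simp: W ramp_def)
  have Z2: "Z (2/3) = 0" by (rule step[of "2/3"]) (auto simp: W Z1 ramp_def)
  have "Z s = 0" if "s \<in> {0..1}" for s by (rule step[of 1]) (use that in \<open>auto simp: W Z1 Z2\<close>)
  then have "U = (\<lambda>x. if x \<in> {0..1} then A * shoot \<mu> x else 0)"
    using H01_outside[OF U] by (auto simp: Z_def)
  then show ?thesis by (rule that)
qed

section \<open>Eigenvalue criterion and simplicity\<close>

lemma shoot_nonzero: "\<exists>x\<in>{0..1}. shoot \<mu> x \<noteq> 0"
proof -
  obtain d where d: "d > 0" "\<And>h. 0 < h \<Longrightarrow> h < d \<Longrightarrow> sn \<mu> 0 < sn \<mu> (0 + h)"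
    using DERIV_pos_inc_right[OF DERIV_sn[of \<mu> 0]] by auto
  \<comment> \<open>The bound 1/4 stays left of the first mass, where \<open>shoot\<close> is
    \<open>sn\<close>, which increases at 0 with slope 1.\<close>
  define h where "h = min (d/2) (1/4)"
  have "0 < h" "h < d" "h \<le> 1/4" using d(1) by (auto simp: h_def)
  then have "shoot \<mu> h = sn \<mu> h" "sn \<mu> h > 0" using d(2)[of h] by (auto simp: shoot_def sn_pos_def)
  then show ?thesis using \<open>0 < h\<close> \<open>h \<le> 1/4\<close> by (intro bexI[of _ h]) auto
qed

lemma is_eigenvalue_iff: "is_eigenvalue \<mu> \<longleftrightarrow> shoot \<mu> 1 = 0"
proof
  assume "is_eigenvalue \<mu>"
  then obtain U where U: "is_solution \<mu> U" "U \<noteq> (\<lambda>_. 0)" by (auto simp: is_eigenvalue_def)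
  obtain A where A: "U = (\<lambda>x. if x \<in> {0..1} then A * shoot \<mu> x else 0)" by (rule solution_is_shoot[OF U(1)])
  have "U 1 = 0" using U(1) by (intro H01_1) (simp add: is_solution_iff)
  moreover have "A \<noteq> 0" using U(2) A by auto
  ultimately show "shoot \<mu> 1 = 0" using A by simp
next
  assume 0: "shoot \<mu> 1 = 0"
  obtain x where "x \<in> {0..1}" "shoot \<mu> x \<noteq> 0" using shoot_nonzero by blast
  then have "(\<lambda>x. if x \<in> {0..1} then 1 * shoot \<mu> x else 0) x \<noteq> 0" by simp
  then have "(\<lambda>x. if x \<in> {0..1} then 1 * shoot \<mu> x else 0) \<noteq> (\<lambda>_. 0)" by metis
  then show "is_eigenvalue \<mu>" unfolding is_eigenvalue_def using shoot_is_solution[OF 0] by blast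
qed

lemma multiplicity_eq_1:
  assumes "is_eigenvalue \<mu>"
  shows "multiplicity_of \<mu> = 1"
proof -
  interpret V: vector_space scale_fun by (rule vector_space_scale_fun)
  define Y where "Y x = (if x \<in> {0..1} then shoot \<mu> x else 0)" for x
  have 0: "shoot \<mu> 1 = 0" using assms by (simp add: is_eigenvalue_iff)
  obtain x where "x \<in> {0..1}" "shoot \<mu> x \<noteq> 0" using shoot_nonzero by blast
  then have "Y x \<noteq> 0" by (simp add: Y_def)
  then have Y: "Y \<noteq> 0" by (auto simp: zero_fun_def)
  have *: "(\<lambda>x. if x \<in> {0..1} then A * shoot \<mu> x else 0) = scale_fun A Y" for A
    by (auto simp: scale_fun_def Y_def)
  have "{U. is_solution \<mu> U} = range (\<lambda>A. scale_fun A Y)"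
  proof (intro equalityI subsetI)
    fix U assume "U \<in> {U. is_solution \<mu> U}"
    then obtain A where "U = scale_fun A Y" using solution_is_shoot[of \<mu> U] unfolding * by blast
    then show "U \<in> range (\<lambda>A. scale_fun A Y)" by blast
  qed (use shoot_is_solution[OF 0, unfolded *] in auto)
  also have "\<dots> = V.span {Y}" by (simp add: V.span_singleton)
  finally show ?thesis
    unfolding multiplicity_of_def using Y by (simp add: V.dim_eq_card_independent V.dim_span)
qed

section \<open>The spectrum\<close>

lemma sn_cs_neg: "\<mu> = - 9 * \<tau>\<^sup>2 \<Longrightarrow> \<tau> > 0 \<Longrightarrow> sn \<mu> (1/3) = sinh \<tau> / (3 * \<tau>) \<and> cs \<mu> (1/3) = cosh \<tau>"
  by (simp add: sn_def cs_def real_sqrt_mult)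

lemma sn_cs_pos: "\<mu> = 9 * \<theta>\<^sup>2 \<Longrightarrow> \<theta> > 0 \<Longrightarrow> sn \<mu> (1/3) = sin \<theta> / (3 * \<theta>) \<and> cs \<mu> (1/3) = cos \<theta>"
  by (simp add: sn_def cs_def real_sqrt_mult)

lemma not_is_eigenvalue_0: "\<not> is_eigenvalue 0"
  by (simp add: is_eigenvalue_iff shoot_1 sn_def cs_def)

text \<open>Half of 2 \<gamma> - 12 \<sigma> at \<open>\<mu> = - 9 * \<tau>\<^sup>2\<close>; the
  remaining factor \<sigma> of \<open>shoot \<mu> 1\<close> is positive there.\<close>

definition disp :: "real \<Rightarrow> real" where "disp \<tau> = cosh \<tau> - 2 * sinh \<tau> / \<tau>"

lemma is_eigenvalue_neg_iff:
  assumes "\<tau> > 0"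
  shows "is_eigenvalue (- 9 * \<tau>\<^sup>2) \<longleftrightarrow> disp \<tau> = 1/2 \<or> disp \<tau> = - 1/2"
proof -
  have *: "sn (- 9 * \<tau>\<^sup>2) (1/3) = sinh \<tau> / (3 * \<tau>)" "cs (- 9 * \<tau>\<^sup>2) (1/3) = cosh \<tau>"
    using sn_cs_neg[OF refl assms] by auto
  show ?thesis
    unfolding is_eigenvalue_iff shoot_1 * using assms by (auto simp: disp_def)
qed

lemma is_eigenvalue_pos_iff:
  assumes "\<theta> > 0"
  shows "is_eigenvalue (9 * \<theta>\<^sup>2) \<longleftrightarrow>
    sin \<theta> = 0 \<or> 2 * \<theta> * cos \<theta> - 4 * sin \<theta> - \<theta> = 0 \<or> 2 * \<theta> * cos \<theta> - 4 * sin \<theta> + \<theta> = 0"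
proof -
  have *: "sn (9 * \<theta>\<^sup>2) (1/3) = sin \<theta> / (3 * \<theta>)" "cs (9 * \<theta>\<^sup>2) (1/3) = cos \<theta>"
    using sn_cs_pos[OF refl assms] by auto
  have "2 * cos \<theta> - 12 * (sin \<theta> / (3 * \<theta>)) - 1 = (2 * \<theta> * cos \<theta> - 4 * sin \<theta> - \<theta>) / \<theta>"
    "2 * cos \<theta> - 12 * (sin \<theta> / (3 * \<theta>)) + 1 = (2 * \<theta> * cos \<theta> - 4 * sin \<theta> + \<theta>) / \<theta>"
    using assms by (simp_all add: field_simps)
  then show ?thesis
    unfolding is_eigenvalue_iff shoot_1 * using assms by simp
qed

text \<open>The derivative is \<open>q x / x\<^sup>2\<close>. The sign of \<open>q\<close> is not
  visible directly, but \<open>q 0 = 0\<close> and all terms of its derivative cancel except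
  \<open>x\<^sup>2 * cosh x\<close>.\<close>

lemma strict_mono_disp:
  assumes ab: "0 < a" "a < b"
  shows "disp a < disp b"
proof (rule DERIV_pos_imp_increasing_open[OF ab(2)])
  fix x assume x: "a < x" "x < b"
  define q where "q x = x\<^sup>2 * sinh x - 2 * x * cosh x + 2 * sinh x" for x :: real
  have "q 0 < q x"
  proof (rule DERIV_pos_imp_increasing_open[of 0 x q])
    show "\<exists>y. (q has_real_derivative y) (at t) \<and> y > 0" if "0 < t" for t
    proof (intro exI[of _ "t\<^sup>2 * cosh t"] conjI)
      show "(q has_real_derivative t\<^sup>2 * cosh t) (at t)"
        unfolding q_def by (auto intro!: derivative_eq_intros simp: algebra_simps)
      show "t\<^sup>2 * cosh t > 0" using that by (simp add: cosh_real_pos)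
    qed
    show "continuous_on {0..x} q" unfolding q_def by (intro continuous_intros)
  qed (use ab x in auto)
  then have "q x > 0" by (simp add: q_def)
  moreover have "(disp has_real_derivative q x / x\<^sup>2) (at x)"
    unfolding disp_def[abs_def] q_def using ab x
    by (auto intro!: derivative_eq_intros simp: field_simps power2_eq_square)
  ultimately show "\<exists>y. (disp has_real_derivative y) (at x) \<and> y > 0"
    using ab x by (intro exI[of _ "q x / x\<^sup>2"]) auto
next
  show "continuous_on {a..b} disp"
    unfolding disp_def[abs_def] using ab by (intro continuous_intros) auto
qed

text \<open>From \<open>exp 1 \<ge> 1 + 1 + 1/2\<close> one gets
  \<open>disp 1 \<le> - 5/4 + 3/5\<close>. Together with the value at 3 this brackets both roots in
  \<open>{1..3}\<close>.\<close>

lemma disp_1: "disp 1 < - 1/2"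
proof -
  have e: "exp 1 \<ge> (5/2 :: real)" using exp_lower_Taylor_quadratic[of 1] by simp
  have "exp (-1) \<le> (2/5 :: real)" using e by (simp add: exp_minus field_simps)
  moreover have "disp 1 = - exp 1 / 2 + 3/2 * exp (-1)"
    by (simp add: disp_def cosh_def sinh_def field_simps)
  ultimately show ?thesis using e by simp
qed

text \<open>As \<open>sinh 3 \<le> cosh 3\<close>, the value is at least \<open>cosh 3 / 3\<close>,
  hence at least \<open>exp 3 / 6\<close>, and \<open>exp 3 \<ge> 4\<close>.\<close>

lemma disp_3: "disp 3 > 1/2"
proof -
  have "cosh 3 - sinh 3 \<ge> (0::real)" by (simp add: cosh_minus_sinh)
  moreover have "cosh 3 \<ge> exp 3 / (2::real)" by (simp add: cosh_def)
  moreover have "exp 3 \<ge> (1 + 3::real)" by (rule exp_ge_add_one_self)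
  ultimately show ?thesis by (simp add: disp_def)
qed

lemma negative_eigenvalues:
  obtains l1 l2 where "l1 < l2" "l2 < 0" "{\<mu>. is_eigenvalue \<mu> \<and> \<mu> < 0} = {l1, l2}"
proof -
  have c: "continuous_on {1..3} disp"
    unfolding disp_def[abs_def] by (intro continuous_intros) auto
  obtain p where p: "1 \<le> p" "disp p = 1/2"
    using IVT'[of disp 1 "1/2" 3] disp_1 disp_3 c by auto
  obtain m where m: "1 \<le> m" "disp m = - 1/2"
    using IVT'[of disp 1 "- 1/2" 3] disp_1 disp_3 c by auto
  have inj: "x = y" if "disp x = disp y" "x > 0" "y > 0" for x y
    using strict_mono_disp[of x y] strict_mono_disp[of y x] that by (cases x y rule: linorder_cases) auto
  \<comment> \<open>By monotonicity the level 1/2 has the larger root; the larger \<tau> belongs to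
    the lower eigenvalue.\<close>
  have "m < p" using strict_mono_disp[of p m] p m by (cases m p rule: linorder_cases) auto
  show ?thesis
  proof
    show "- 9 * p\<^sup>2 < - 9 * m\<^sup>2" using \<open>m < p\<close> m by (simp add: power_strict_mono)
    show "- 9 * m\<^sup>2 < 0" using m by simp
    show "{\<mu>. is_eigenvalue \<mu> \<and> \<mu> < 0} = {- 9 * p\<^sup>2, - 9 * m\<^sup>2}"
    proof (intro equalityI subsetI)
      fix \<mu> assume "\<mu> \<in> {\<mu>. is_eigenvalue \<mu> \<and> \<mu> < 0}"
      then have \<mu>: "is_eigenvalue \<mu>" "\<mu> < 0" by auto
      define \<tau> where "\<tau> = sqrt (- \<mu>) / 3"
      have t: "\<tau> > 0" "\<mu> = - 9 * \<tau>\<^sup>2" using \<mu>(2) by (auto simp: \<tau>_def power_divide)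
      then have "disp \<tau> = disp p \<or> disp \<tau> = disp m" using \<mu>(1) is_eigenvalue_neg_iff[OF t(1)] p m by auto
      then have "\<tau> = p \<or> \<tau> = m" using inj t(1) p m by auto
      then show "\<mu> \<in> {- 9 * p\<^sup>2, - 9 * m\<^sup>2}" using t by auto
    next
      fix \<mu> assume "\<mu> \<in> {- 9 * p\<^sup>2, - 9 * m\<^sup>2}"
      then show "\<mu> \<in> {\<mu>. is_eigenvalue \<mu> \<and> \<mu> < 0}"
        using is_eigenvalue_neg_iff[of p] is_eigenvalue_neg_iff[of m] p m by auto
    qed
  qed
qed

text \<open>Multiplying the two transcendental factors by \<theta> clears the denominators and
  leaves an entire function. Infinitely many zeros in a compact disc would accumulate and force it
  to vanish identically.\<close>

lemma finite_eigenvalues_le: "finite {\<mu>. is_eigenvalue \<mu> \<and> 0 < \<mu> \<and> \<mu> \<le> B}"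
proof -
  define f :: "complex \<Rightarrow> complex" where
    "f z = sin z * (2 * z * cos z - 4 * sin z - z) * (2 * z * cos z - 4 * sin z + z)" for z
  define K where "K = cball (0::complex) (sqrt B)"
  have hol: "f holomorphic_on UNIV" unfolding f_def by (intro holomorphic_intros)
  \<comment> \<open>At \<pi>/2 the cosine is 0 and the sine is 1, so the value is explicit; it is
    nonzero because \<pi>/2 is less than 4.\<close>
  have f0: "f (of_real (pi/2)) \<noteq> 0"
  proof -
    have "f (of_real (pi/2)) = of_real ((- 4 - pi/2) * (- 4 + pi/2))"
      unfolding f_def by (simp flip: sin_of_real cos_of_real)
    moreover have "- 4 - pi/2 \<noteq> 0" "- 4 + pi/2 \<noteq> 0" using pi_gt_zero pi_less_4 by linarith+
    ultimately show ?thesis by (metis mult_eq_0_iff of_real_eq_0_iff)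
  qed
  have fin: "finite {z \<in> K. f z = 0}"
  proof (rule ccontr)
    assume inf: "infinite {z \<in> K. f z = 0}"
    have "compact K" by (simp add: K_def)
    then obtain z where z: "z \<in> K" "z islimpt {z \<in> K. f z = 0}"
      using inf by (auto simp: compact_eq_Bolzano_Weierstrass dest!: spec[of _ "{z \<in> K. f z = 0}"])
    have "f (of_real (pi/2)) = 0"
      by (rule analytic_continuation[OF hol open_UNIV connected_UNIV _ _ z(2)]) auto
    then show False using f0 by simp
  qed
  \<comment> \<open>Only an inclusion is claimed, so zeros of \<open>f\<close> that give no positive
    eigenvalue, such as 0, do no harm.\<close>
  have "{\<mu>. is_eigenvalue \<mu> \<and> 0 < \<mu> \<and> \<mu> \<le> B} \<subseteq> (\<lambda>z. 9 * (Re z)\<^sup>2) ` {z \<in> K. f z = 0}"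
  proof
    fix \<mu> assume "\<mu> \<in> {\<mu>. is_eigenvalue \<mu> \<and> 0 < \<mu> \<and> \<mu> \<le> B}"
    then have \<mu>: "is_eigenvalue \<mu>" "0 < \<mu>" "\<mu> \<le> B" by auto
    define \<theta> where "\<theta> = sqrt \<mu> / 3"
    have t: "\<theta> > 0" "\<mu> = 9 * \<theta>\<^sup>2" using \<mu>(2) by (auto simp: \<theta>_def power_divide)
    have "sqrt \<mu> \<le> sqrt B" "sqrt \<mu> \<ge> 0" using \<mu> by auto
    then have "\<theta> \<le> sqrt B" unfolding \<theta>_def by linarith
    then have K: "of_real \<theta> \<in> K" using t by (simp add: K_def)
    have "sin \<theta> * (2 * \<theta> * cos \<theta> - 4 * sin \<theta> - \<theta>) * (2 * \<theta> * cos \<theta> - 4 * sin \<theta> + \<theta>) = 0"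
      using \<mu>(1) is_eigenvalue_pos_iff[OF t(1)] t(2) by auto
    moreover have "f (of_real \<theta>) = of_real (sin \<theta> * (2 * \<theta> * cos \<theta> - 4 * sin \<theta> - \<theta>) * (2 * \<theta> * cos \<theta> - 4 * sin \<theta> + \<theta>))"
      by (simp add: f_def flip: sin_of_real cos_of_real)
    ultimately have "f (of_real \<theta>) = 0" by (simp only: of_real_0)
    then show "\<mu> \<in> (\<lambda>z. 9 * (Re z)\<^sup>2) ` {z \<in> K. f z = 0}"
      using K t(2) by (intro image_eqI[of _ _ "of_real \<theta>"]) auto
  qed
  then show ?thesis using finite_imageI[OF fin] finite_subset by blast
qed

lemma infinite_positive_eigenvalues: "infinite {\<mu>. is_eigenvalue \<mu> \<and> 0 < \<mu>}"
proof -
  \<comment> \<open>These belong to the sine modes that vanish at both masses and so do not feel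
    them; \<open>Suc n\<close> excludes \<theta> = 0.\<close>
  define h where "h n = 9 * (pi * real (Suc n))\<^sup>2" for n
  have "inj h"
  proof (rule injI)
    fix m n assume "h m = h n"
    then have "(pi * real (Suc m))\<^sup>2 = (pi * real (Suc n))\<^sup>2" by (simp add: h_def)
    then have "pi * real (Suc m) = pi * real (Suc n)" by (rule power2_eq_imp_eq) (auto simp del: of_nat_Suc)
    then show "m = n" by (simp del: of_nat_Suc)
  qed
  then have "infinite (range h)" by (rule range_inj_infinite)
  moreover have "range h \<subseteq> {\<mu>. is_eigenvalue \<mu> \<and> 0 < \<mu>}"
  proof
    fix \<mu> assume "\<mu> \<in> range h"
    then obtain n where n: "\<mu> = 9 * (pi * real (Suc n))\<^sup>2" by (auto simp: h_def)
    have p: "pi * real (Suc n) > 0" by (simp del: of_nat_Suc)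
    have "sin (pi * real (Suc n)) = 0" by (simp only: sin_npi2)
    then have "is_eigenvalue \<mu>" unfolding n is_eigenvalue_pos_iff[OF p] by simp
    moreover have "\<mu> > 0" unfolding n using p by simp
    ultimately show "\<mu> \<in> {\<mu>. is_eigenvalue \<mu> \<and> 0 < \<mu>}" by simp
  qed
  ultimately show ?thesis using finite_subset by blast
qed

section \<open>Increasing enumeration of the eigenvalues\<close>

lemma locally_finite_enumeration:
  fixes S :: "real set"
  assumes inf: "infinite S" and fin: "\<And>B. finite {x \<in> S. x \<le> B}"
  obtains e :: "nat \<Rightarrow> real" where "strict_mono e" "range e = S"
proof -
  \<comment> \<open>The rank of an element. It is strictly increasing on \<open>S\<close>, and its
    inverse is the enumeration once every natural number is known to be a rank.\<close>
  define r where "r x = card {y \<in> S. y < x}" for x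
  have fin': "finite {y \<in> S. y < x}" for x by (rule finite_subset[OF _ fin[of x]]) auto
  have r_less: "r x < r y" if "x \<in> S" "x < y" for x y
    unfolding r_def using that by (intro psubset_card_mono fin') auto
  have r_inj: "inj_on r S"
    by (rule linorder_inj_onI) (use r_less in \<open>force+\<close>)
  \<comment> \<open>The \<open>r x\<close> elements below \<open>x\<close> have distinct ranks, all
    less than \<open>r x\<close>, so they exhaust these numbers. The set of ranks is thus closed
    downwards and, being infinite, is everything.\<close>
  have "{..< r x} \<subseteq> r ` S" if "x \<in> S" for x
  proof -
    have "r ` {y \<in> S. y < x} \<subseteq> {..< r x}" using r_less by auto
    moreover have "card (r ` {y \<in> S. y < x}) = card {..< r x}"
      using inj_on_subset[OF r_inj] by (subst card_image) (auto simp: r_def)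
    ultimately have "r ` {y \<in> S. y < x} = {..< r x}" by (intro card_subset_eq) auto
    then show ?thesis by blast
  qed
  moreover have "\<exists>x\<in>S. n < r x" for n
  proof -
    have "infinite (r ` S)" using inf finite_imageD[OF _ r_inj] by blast
    then show ?thesis unfolding infinite_nat_iff_unbounded by blast
  qed
  ultimately have r_surj: "r ` S = UNIV" by blast
  define e where "e = inv_into S r"
  have eS: "e n \<in> S" "r (e n) = n" for n
    unfolding e_def using r_surj by (auto intro: inv_into_into f_inv_into_f)
  have "strict_mono e"
  proof (rule strict_monoI)
    fix m n :: nat assume "m < n"
    then show "e m < e n"
      using r_less[of "e n" "e m"] eS[of m] eS[of n] by (cases "e m" "e n" rule: linorder_cases) auto
  qed
  moreover have "range e = S"
  proof
    show "range e \<subseteq> S" using eS by auto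
    show "S \<subseteq> range e"
    proof
      fix x assume "x \<in> S"
      then have "e (r x) = x" unfolding e_def using r_inj by simp
      then show "x \<in> range e" by (metis rangeI)
    qed
  qed
  ultimately show ?thesis by (rule that)
qed

theorem proposition6:
  shows "\<exists>ev :: nat \<Rightarrow> real.
    ev 1 < ev 2 \<and> ev 2 < 0 \<and> {\<mu>. is_eigenvalue \<mu> \<and> \<mu> < 0} = {ev 1, ev 2} \<and>
    \<not> is_eigenvalue 0 \<and>
    infinite {\<mu>. is_eigenvalue \<mu> \<and> 0 < \<mu>} \<and> countable {\<mu>. is_eigenvalue \<mu> \<and> 0 < \<mu>} \<and>
    0 < ev 3 \<and> (\<forall>n\<ge>3. ev n \<le> ev (n + 1)) \<and>
    {\<mu>. is_eigenvalue \<mu> \<and> 0 < \<mu>} = ev ` {3..} \<and>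
    (\<forall>\<mu>. is_eigenvalue \<mu> \<longrightarrow> card {n. 1 \<le> n \<and> ev n = \<mu>} = multiplicity_of \<mu>)"
proof -
  obtain l1 l2 where l: "l1 < l2" "l2 < 0" "{\<mu>. is_eigenvalue \<mu> \<and> \<mu> < 0} = {l1, l2}"
    by (rule negative_eigenvalues)
  define S where "S = {\<mu>. is_eigenvalue \<mu> \<and> 0 < \<mu>}"
  have inf: "infinite S" unfolding S_def by (rule infinite_positive_eigenvalues)
  have fin: "finite {x \<in> S. x \<le> B}" for B using finite_eigenvalues_le[of B] by (simp add: S_def conj_assoc)
  obtain e :: "nat \<Rightarrow> real" where e: "strict_mono e" "range e = S" by (rule locally_finite_enumeration[OF inf fin])
  have epos: "e k > 0" for k using e(2) by (auto simp: S_def)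
  \<comment> \<open>The shift by 3 places the positive eigenvalues at indices from 3 on; the value
    at index 0 is a filler, as counting starts at 1.\<close>
  define ev where "ev n = (if n \<le> 1 then l1 else if n = 2 then l2 else e (n - 3))" for n :: nat
  \<comment> \<open>Strict increase means that each eigenvalue is listed exactly once, which agrees
    with its multiplicity because all eigenvalues are simple.\<close>
  have lt: "ev m < ev n" if "1 \<le> m" "m < n" for m n
    using that l strict_monoD[OF e(1), of "m - 3" "n - 3"] epos[of "n - 3"] by (auto simp: ev_def)
  have img: "ev ` {3..} = S"
  proof
    show "ev ` {3..} \<subseteq> S" using e(2) by (auto simp: ev_def)
    show "S \<subseteq> ev ` {3..}"
    proof
      fix x assume "x \<in> S"
      then obtain k where "x = e k" using e(2) by auto
      then show "x \<in> ev ` {3..}" by (intro image_eqI[of _ _ "k + 3"]) (auto simp: ev_def)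
    qed
  qed
  have neg: "{\<mu>. is_eigenvalue \<mu> \<and> \<mu> < 0} = {ev 1, ev 2}" using l by (simp add: ev_def)
  have "card {n. 1 \<le> n \<and> ev n = \<mu>} = multiplicity_of \<mu>" if \<mu>: "is_eigenvalue \<mu>" for \<mu>
  proof -
    have "\<exists>n\<ge>1. ev n = \<mu>"
    proof (cases \<mu> "0::real" rule: linorder_cases)
      case less
      then have "\<mu> = ev 1 \<or> \<mu> = ev 2" using neg \<mu> by blast
      then show ?thesis by (metis le_numeral_extra(4) one_le_numeral)
    next
      case greater
      then have "\<mu> \<in> ev ` {3..}" using \<mu> img by (simp add: S_def)
      then obtain n where "n \<ge> 3" "ev n = \<mu>" by auto
      then show ?thesis by (intro exI[of _ n]) auto
    qed (use \<mu> not_is_eigenvalue_0 in auto)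
    then obtain n where n: "n \<ge> 1" "ev n = \<mu>" by blast
    have "m = n" if "1 \<le> m" "ev m = \<mu>" for m
      using lt[of m n] lt[of n m] n that by (cases m n rule: linorder_cases) auto
    then have "{n. 1 \<le> n \<and> ev n = \<mu>} = {n}" using n by blast
    then show ?thesis using multiplicity_eq_1[OF \<mu>] by simp
  qed
  moreover have "countable S" using e(2) by (metis countable_image countableI_type)
  moreover have "ev n \<le> ev (n + 1)" if "n \<ge> 3" for n using lt[of n "n + 1"] that by simp
  moreover have "ev 1 < ev 2" "ev 2 < 0" "0 < ev 3" using l epos by (auto simp: ev_def)
  ultimately show ?thesis
    using neg img inf not_is_eigenvalue_0 unfolding S_def by (intro exI[of _ ev]) auto
qed

end
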